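(* Fix an integer $k\ge1$ and a real number $a>0$. Then the series $\sum_{n=0}^\infty(-1)^n(kn)!\,a^n$ is $C$-summable, and its $C$-sum is $$C\left(\sum_{n=0}^\infty(-1)^n(kn)!\,a^n\right)=\int_0^\infty\frac{e^{-x}}{1+ax^k}\,dx.$$
   Context: **Germs and log-exp monomials.** Functions are germs at $+\infty$ on the positive real axis: two are identified if they agree for all sufficiently large real $x$. Put $\ell_0(x)=x$, $\ell_{j+1}(x)=\log\ell_j(x)$. $\mathcal P$ is the group of germs $\prod_{j=0}^r\ell_j(x)^{\alpha_j}$, $\alpha_j\in\mathbb R$. Let $\mathcal L_0=\mathcal P$. Given $\mathcal L_{\le h}=\bigcup_{q=0}^h\mathcal L_q$, a reduced exponent of height at most $h$ is a finite (possibly empty) sum $\Phi=\sum_\nu c_\nu M_\nu$ with $c_\nu\in\mathbb R\setminus\{0\}$, the $M_\nu\in\mathcal L_{\le h}$ distinct, each $M_\nu(x)\to+\infty$, and no $M_\nu$ equal to an iterated logarithm $\ell_j$ with $j\ge1$. $\mathcal L_{h+1}$ is the set of germs $\exp(\Phi(x))P(x)$ with $P\in\mathcal P$ and $\Phi$ a reduced exponent of height at most $h$; $\mathcal L=\bigcup_{h\ge0}\mathcal L_h$. The reduced expression is part of the data of an element of $\mathcal L$. Write $f\prec g$ (or $g\succ f$) if $f(x)/g(x)\to0$ as $x\to+\infty$. Let $\mathcal L_{<x}=\{L\in\mathcal L:\log L(x)=o(x)\}$. $L\in\mathcal L$ is gamma-resonant if there are $\lambda\in\mathbb R$, $H\in\mathcal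 L_{<x}$, $\kappa>0$ and $C\in\mathbb R_{>0}$ with $L(x)/(e^{\lambda x}H(x)\Gamma(\kappa x+1))\to C$. **Growth monomials, $\mathcal M$, $\mathcal M^\flat$.** A growth monomial is either a pure log-exp germ $L\in\mathcal L$ that is not gamma-resonant, or a gamma-type germ $e^{\lambda x}H(x)\Gamma(\kappa x+1)$ with $\lambda\in\mathbb R$, $H\in\mathcal L_{<x}$, $\kappa>0$. $\mathcal M$ consists of the zero germ and all finite sums $\sum_{j=1}^r(A_j+B_je^{i\pi x})M_j(x)$ with growth monomials $M_1\succ\cdots\succ M_r$ and $(A_j,B_j)\in\mathbb C^2\setminus\{(0,0)\}$. $\mathcal M^\flat$ consists of the zero germ and all finite sums $\sum_{j=1}^rC_jM_j(x)$ with growth monomials $M_1\succ\cdots\succ M_r$ and $C_j\in\mathbb C\setminus\{0\}$. The phase split of $c=\sum_j(A_j+B_je^{i\pi x})M_j\in\mathcal M$ is $c=c^{(+)}+e^{i\pi x}c^{(-)}$ with $c^{(+)}=\sum_jA_jM_j$, $c^{(-)}=\sum_jB_jM_j\in\mathcal M^\flat$. **Canonical continuation.** A growth monomial is continued to some right half-plane by replacing $x$ by $z$ in its reduced expression (principal branches of iterated logarithms and powers; for gamma-type, $M(z)=e^{\lambda z}H(z)\Gamma(\kappa z+1)$). $a=\sum C_jM_j\in\mathcal M^\flat$ is continued by $a(z)=\sum C_jM_j(z)$; the zero germ by $0$. **Bromwich transform.** $a\in\mathcal M^\flat$ is Bromwich-admissible if there is $\sigma_0\in\mathbb R$ such that for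 every $\sigma>\sigma_0$: (1) $\mathcal B[a](u)=\frac1{2\pi i}\int_{\sigma-i\infty}^{\sigma+i\infty}a(z)e^{-uz}\,dz$ converges absolutely for almost every $u\in\mathbb R$; (2) $\mathcal B[a](u)$ does not depend on $\sigma>\sigma_0$; (3) for every sufficiently large integer $N$, $\int_{-\infty}^\infty\mathcal B[a](u)e^{Nu}\,du$ converges absolutely and equals $a(N)$. **Selectors.** For Bromwich-admissible $a$, $\mathcal S_+[a](N)=PV\int_{-\infty}^\infty\frac{\mathcal B[a](u)e^{Nu}}{1-e^u}du$, whenever the integral converges absolutely away from $u=0$ and the principal value $\lim_{\varepsilon\to0^+}\int_{|u|>\varepsilon}$ exists; $\mathcal S_-[a](N)=\int_{-\infty}^\infty\frac{\mathcal B[a](u)e^{Nu}}{1+e^u}du$, whenever it converges absolutely. $c\in\mathcal M$ admits a canonical selector if $c^{(\pm)}$ are Bromwich-admissible and $\mathcal S_+[c^{(+)}](N)$, $\mathcal S_-[c^{(-)}](N)$ exist for all sufficiently large $N$; then $U_c(N)=\mathcal S_+[c^{(+)}](N)+(-1)^N\mathcal S_-[c^{(-)}](N)$. **Admissibility and finite part.** A sequence $U$ (defined for large $N$) is shift-nonresonant if either $U_N\to0$ or there are $\varepsilon>0$, $N_0$ with $|U_N-U_{N+1}|\ge\varepsilon|U_N|$ for $N\ge N_0$. For a complex sequence $R=(R_N)_{N\ge0}$ put $c_N=R_N-R_{N+1}$. $R$ is $\mathcal M$-admissible if either $c_N=0$ for all large $N$, or there is $c\in\mathcal M$ with $c(N)=c_N$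 for all large integers $N$ which admits a canonical selector $U_c$ that is shift-nonresonant (such $c$ is unique). For $\mathcal M$-admissible $R$, $\mathrm{FP}_\infty(R)$ is the eventual constant value of $R_N$ if $c_N=0$ eventually, and otherwise the eventual constant value of $R_N-U_c(N)$. **$C$-summation.** A recurrence presentation of a formal series $\sum_{k\ge0}c_k$ consists of $n_0\in\mathbb N$, functions $a,b:\mathbb N\to\mathbb C$ with $a(n),b(n)\ne0$ for $n\ge n_0$, and complex $\mu_n$ such that $c_k=(-1)^k\mu_{n_0+k}\prod_{j=0}^{k-1}\frac{b(n_0+j)}{a(n_0+j+1)}$ for all $k\ge0$ (empty product $=1$). Put $P(n,n_0)=\prod_{k=n_0}^{n-1}(-a(k)/b(k))$. For a solution $(I_n)_{n\ge n_0}$ of $a(n)I_n+b(n)I_{n+1}=\mu_n$ the normalized tail is $R_N=a(n_0)I_{n_0+N}/P(n_0+N,n_0)$. The series is $C$-summable if some presentation has a solution with $\mathcal M$-admissible normalized tail $R$; its $C$-sum is then $C(\sum c_k)=a(n_0)I_{n_0}-\mathrm{FP}_\infty(R)$ (a value independent of the presentation and solution). *)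

theory Defs
  imports "HOL-Analysis.Analysis" "HOL-Library.Landau_Symbols"
begin

section \<open>Log-exp monomials\<close>

text \<open>
  All expressions are evaluated polymorphically: at type real this gives the germ at infinity,
  at type complex it gives the canonical continuation (x replaced by z in the reduced expression,
  with the principal branches that the library uses for the logarithm and for powers).
  Values at arguments where an iterated logarithm is not yet positive are irrelevant: everything
  below only looks at large real x, resp. at vertical lines Re z = \<sigma> with \<sigma> large.
\<close>

primrec iter_ln :: "nat \<Rightarrow> 'a::ln \<Rightarrow> 'a" where
  "iter_ln 0 z = z"
| "iter_ln (Suc j) z = ln (iter_ln j z)"

definition pow_log :: "real list \<Rightarrow> 'a::{real_normed_field, ln} \<Rightarrow> 'a" where
  "pow_log \<alpha>s z = (\<Prod>j<length \<alpha>s. iter_ln j z powr of_real (\<alpha>s ! j))"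

text \<open>
  The reduced expression is part of the data of a log-exp monomial, so monomials are syntax:
  the term \<open>LogExp [(c\<^sub>1, M\<^sub>1), \<dots>] \<alpha>s\<close> stands for \<open>exp (c\<^sub>1 M\<^sub>1 + \<dots>) P\<close>, where \<open>\<alpha>s\<close> lists the
  exponents of the iterated logarithms in \<open>P\<close>.
\<close>

datatype logexp = LogExp "(real \<times> logexp) list" "real list"

fun lx_eval :: "logexp \<Rightarrow> 'a::{real_normed_field, ln} \<Rightarrow> 'a" where
  "lx_eval (LogExp \<Phi> \<alpha>s) z = exp (\<Sum>(c, M)\<leftarrow>\<Phi>. of_real c * lx_eval M z) * pow_log \<alpha>s z"

definition germ_eq :: "(real \<Rightarrow> 'b) \<Rightarrow> (real \<Rightarrow> 'b) \<Rightarrow> bool" where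
  "germ_eq f g \<longleftrightarrow> (\<forall>\<^sub>F x in at_top. f x = g x)"

definition reduced_exponent :: "logexp set \<Rightarrow> (real \<times> logexp) list \<Rightarrow> bool" where
  "reduced_exponent S \<Phi> \<longleftrightarrow>
     (\<forall>(c, M) \<in> set \<Phi>. c \<noteq> 0 \<and> M \<in> S \<and> filterlim (lx_eval M :: real \<Rightarrow> real) at_top at_top \<and>
        (\<forall>j\<ge>1. \<not> germ_eq (lx_eval M) (iter_ln j))) \<and>
     sorted_wrt (\<lambda>(_, M) (_, M'). \<not> germ_eq (lx_eval M) (lx_eval M' :: real \<Rightarrow> real)) \<Phi>"

text \<open>\<open>LE_upto h\<close> is the union of the first levels, from 0 up to and including \<open>h\<close>.\<close>

primrec LE_upto :: "nat \<Rightarrow> logexp set" where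
  "LE_upto 0 = {LogExp [] \<alpha>s | \<alpha>s. True}"
| "LE_upto (Suc h) = LE_upto h \<union> {LogExp \<Phi> \<alpha>s | \<Phi> \<alpha>s. reduced_exponent (LE_upto h) \<Phi>}"

definition LE :: "logexp set" where
  "LE = (\<Union>h. LE_upto h)"

definition LE_subexp :: "logexp set" where
  "LE_subexp = {L \<in> LE. (\<lambda>x::real. ln (lx_eval L x)) \<in> o[at_top](\<lambda>x. x)}"


section \<open>Growth monomials\<close>

definition gamma_germ ::
    "real \<Rightarrow> logexp \<Rightarrow> real \<Rightarrow> 'a::{Gamma, ln} \<Rightarrow> 'a" where
  "gamma_germ \<theta> H \<kappa> z = exp (of_real \<theta> * z) * lx_eval H z * Gamma (of_real \<kappa> * z + 1)"

definition gamma_resonant :: "logexp \<Rightarrow> bool" where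
  "gamma_resonant L \<longleftrightarrow>
     (\<exists>\<theta> H \<kappa> C. H \<in> LE_subexp \<and> \<kappa> > 0 \<and> C > 0 \<and>
        ((\<lambda>x::real. lx_eval L x / gamma_germ \<theta> H \<kappa> x) \<longlongrightarrow> C) at_top)"

datatype gmon = Pure logexp | GammaType real logexp real

definition growth_monomials :: "gmon set" where
  "growth_monomials =
     {Pure L | L. L \<in> LE \<and> \<not> gamma_resonant L} \<union>
     {GammaType \<theta> H \<kappa> | \<theta> H \<kappa>. H \<in> LE_subexp \<and> \<kappa> > 0}"

fun gm_eval :: "gmon \<Rightarrow> 'a::{Gamma, ln} \<Rightarrow> 'a" where
  "gm_eval (Pure L) z = lx_eval L z"
| "gm_eval (GammaType \<theta> H \<kappa>) z = gamma_germ \<theta> H \<kappa> z"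

definition dominates :: "gmon \<Rightarrow> gmon \<Rightarrow> bool" where
  "dominates M M' \<longleftrightarrow> ((\<lambda>x::real. gm_eval M' x / gm_eval M x) \<longlongrightarrow> 0) at_top"


section \<open>The classes of finite sums, with and without the oscillating phase\<close>

text \<open>
  Finite sums are given by the lists of their terms, in strictly decreasing order of growth; the
  empty list is the zero germ.
\<close>

definition MM :: "((complex \<times> complex) \<times> gmon) list set" where
  "MM = {c. (\<forall>(AB, M) \<in> set c. AB \<noteq> (0, 0) \<and> M \<in> growth_monomials) \<and>
            sorted_wrt dominates (map snd c)}"

definition MM_germ :: "((complex \<times> complex) \<times> gmon) list \<Rightarrow> real \<Rightarrow> complex" where
  "MM_germ c x =
     (\<Sum>((A, B), M)\<leftarrow>c. (A + B * exp (\<i> * of_real (pi * x))) * of_real (gm_eval M x))"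

definition MF :: "(complex \<times> gmon) list set" where
  "MF = {a. (\<forall>(C, M) \<in> set a. C \<noteq> 0 \<and> M \<in> growth_monomials) \<and>
            sorted_wrt dominates (map snd a)}"

definition MF_germ :: "(complex \<times> gmon) list \<Rightarrow> real \<Rightarrow> complex" where
  "MF_germ a x = (\<Sum>(C, M)\<leftarrow>a. C * of_real (gm_eval M x))"

definition MF_cont :: "(complex \<times> gmon) list \<Rightarrow> complex \<Rightarrow> complex" where
  "MF_cont a z = (\<Sum>(C, M)\<leftarrow>a. C * gm_eval M z)"

text \<open>The phase split; terms whose coefficient vanishes are dropped.\<close>

definition phase_plus :: "((complex \<times> complex) \<times> gmon) list \<Rightarrow> (complex \<times> gmon) list" where
  "phase_plus c = filter (\<lambda>(C, _). C \<noteq> 0) (map (\<lambda>((A, B), M). (A, M)) c)"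

definition phase_minus :: "((complex \<times> complex) \<times> gmon) list \<Rightarrow> (complex \<times> gmon) list" where
  "phase_minus c = filter (\<lambda>(C, _). C \<noteq> 0) (map (\<lambda>((A, B), M). (B, M)) c)"


section \<open>Bromwich transform and selectors\<close>

definition bromwich_integrand ::
    "(complex \<times> gmon) list \<Rightarrow> real \<Rightarrow> real \<Rightarrow> real \<Rightarrow> complex" where
  "bromwich_integrand a \<sigma> u y = MF_cont a (Complex \<sigma> y) * exp (- (of_real u * Complex \<sigma> y))"

text \<open>The factor \<open>\<i>\<close> in the integral comes from \<open>dz = \<i> dy\<close> on the line \<open>z = \<sigma> + \<i> y\<close>.\<close>

definition bromwich_line :: "(complex \<times> gmon) list \<Rightarrow> real \<Rightarrow> real \<Rightarrow> complex" where
  "bromwich_line a \<sigma> u =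
     1 / (2 * of_real pi * \<i>) * (LINT y|lborel. bromwich_integrand a \<sigma> u y * \<i>)"

definition bromwich_admissible :: "(complex \<times> gmon) list \<Rightarrow> bool" where
  "bromwich_admissible a \<longleftrightarrow> a \<in> MF \<and>
     (\<exists>\<sigma>0. \<forall>\<sigma>>\<sigma>0.
        (AE u in lborel. integrable lborel (bromwich_integrand a \<sigma> u)) \<and>
        (\<forall>\<sigma>'>\<sigma>0. \<forall>u. bromwich_line a \<sigma>' u = bromwich_line a \<sigma> u) \<and>
        (\<forall>\<^sub>F N::nat in sequentially.
           integrable lborel (\<lambda>u. bromwich_line a \<sigma> u * of_real (exp (real N * u))) \<and>
           (LINT u|lborel. bromwich_line a \<sigma> u * of_real (exp (real N * u))) = MF_germ a (real N)))"

text \<open>The common value of the line integrals for all large \<open>\<sigma>\<close>.\<close>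

definition bromwich :: "(complex \<times> gmon) list \<Rightarrow> real \<Rightarrow> complex" where
  "bromwich a u = (THE v. \<forall>\<^sub>F \<sigma> in at_top. bromwich_line a \<sigma> u = v)"

definition sel_plus_integrand :: "(complex \<times> gmon) list \<Rightarrow> nat \<Rightarrow> real \<Rightarrow> complex" where
  "sel_plus_integrand a N u = bromwich a u * of_real (exp (real N * u) / (1 - exp u))"

definition sel_minus_integrand :: "(complex \<times> gmon) list \<Rightarrow> nat \<Rightarrow> real \<Rightarrow> complex" where
  "sel_minus_integrand a N u = bromwich a u * of_real (exp (real N * u) / (1 + exp u))"

definition sel_plus_cut :: "(complex \<times> gmon) list \<Rightarrow> nat \<Rightarrow> real \<Rightarrow> complex" where
  "sel_plus_cut a N \<epsilon> = (LINT u:{u. \<bar>u\<bar> > \<epsilon>}|lborel. sel_plus_integrand a N u)"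

definition sel_plus_exists :: "(complex \<times> gmon) list \<Rightarrow> nat \<Rightarrow> bool" where
  "sel_plus_exists a N \<longleftrightarrow>
     (\<forall>\<epsilon>>0. set_integrable lborel {u. \<bar>u\<bar> > \<epsilon>} (sel_plus_integrand a N)) \<and>
     (\<exists>l. (sel_plus_cut a N \<longlongrightarrow> l) (at_right 0))"

definition sel_plus :: "(complex \<times> gmon) list \<Rightarrow> nat \<Rightarrow> complex" where
  "sel_plus a N = Lim (at_right 0) (sel_plus_cut a N)"

definition sel_minus_exists :: "(complex \<times> gmon) list \<Rightarrow> nat \<Rightarrow> bool" where
  "sel_minus_exists a N \<longleftrightarrow> integrable lborel (sel_minus_integrand a N)"

definition sel_minus :: "(complex \<times> gmon) list \<Rightarrow> nat \<Rightarrow> complex" where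
  "sel_minus a N = (LINT u|lborel. sel_minus_integrand a N u)"

definition admits_selector :: "((complex \<times> complex) \<times> gmon) list \<Rightarrow> bool" where
  "admits_selector c \<longleftrightarrow>
     bromwich_admissible (phase_plus c) \<and> bromwich_admissible (phase_minus c) \<and>
     (\<forall>\<^sub>F N in sequentially. sel_plus_exists (phase_plus c) N \<and> sel_minus_exists (phase_minus c) N)"

definition selector :: "((complex \<times> complex) \<times> gmon) list \<Rightarrow> nat \<Rightarrow> complex" where
  "selector c N = sel_plus (phase_plus c) N + (-1) ^ N * sel_minus (phase_minus c) N"


section \<open>Admissible sequences and the finite part at infinity\<close>

definition shift_nonresonant :: "(nat \<Rightarrow> complex) \<Rightarrow> bool" where
  "shift_nonresonant U \<longleftrightarrow>
     U \<longlonglongrightarrow> 0 \<or> (\<exists>\<epsilon>>0. \<exists>N0. \<forall>N\<ge>N0. norm (U N - U (Suc N)) \<ge> \<epsilon> * norm (U N))"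

definition selects :: "((complex \<times> complex) \<times> gmon) list \<Rightarrow> (nat \<Rightarrow> complex) \<Rightarrow> bool" where
  "selects c R \<longleftrightarrow> c \<in> MM \<and>
     (\<forall>\<^sub>F N in sequentially. MM_germ c (real N) = R N - R (Suc N)) \<and>
     admits_selector c \<and> shift_nonresonant (selector c)"

definition MM_admissible :: "(nat \<Rightarrow> complex) \<Rightarrow> bool" where
  "MM_admissible R \<longleftrightarrow>
     (\<forall>\<^sub>F N in sequentially. R N - R (Suc N) = 0) \<or> (\<exists>c. selects c R)"

text \<open>
  The element \<open>c\<close> is unique only as a germ (its list representation may differ, for instance, by
  trailing zero exponents), so it is quantified inside the definite description of the value.
\<close>

definition FP_inf :: "(nat \<Rightarrow> complex) \<Rightarrow> complex" where
  "FP_inf R =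
     (if \<forall>\<^sub>F N in sequentially. R N - R (Suc N) = 0
      then THE v. \<forall>\<^sub>F N in sequentially. R N = v
      else THE v. \<exists>c. selects c R \<and> (\<forall>\<^sub>F N in sequentially. R N - selector c N = v))"


section \<open>C-summation\<close>

definition recurrence_presentation ::
    "(nat \<Rightarrow> complex) \<Rightarrow> nat \<Rightarrow> (nat \<Rightarrow> complex) \<Rightarrow> (nat \<Rightarrow> complex) \<Rightarrow> (nat \<Rightarrow> complex) \<Rightarrow> bool" where
  "recurrence_presentation s n0 a b \<mu> \<longleftrightarrow>
     (\<forall>n\<ge>n0. a n \<noteq> 0 \<and> b n \<noteq> 0) \<and>
     (\<forall>k. s k = (-1) ^ k * \<mu> (n0 + k) * (\<Prod>j<k. b (n0 + j) / a (n0 + j + 1)))"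

definition recurrence_solution ::
    "nat \<Rightarrow> (nat \<Rightarrow> complex) \<Rightarrow> (nat \<Rightarrow> complex) \<Rightarrow> (nat \<Rightarrow> complex) \<Rightarrow> (nat \<Rightarrow> complex) \<Rightarrow> bool" where
  "recurrence_solution n0 a b \<mu> I \<longleftrightarrow> (\<forall>n\<ge>n0. a n * I n + b n * I (n + 1) = \<mu> n)"

definition normalized_tail ::
    "nat \<Rightarrow> (nat \<Rightarrow> complex) \<Rightarrow> (nat \<Rightarrow> complex) \<Rightarrow> (nat \<Rightarrow> complex) \<Rightarrow> nat \<Rightarrow> complex" where
  "normalized_tail n0 a b I N = a n0 * I (n0 + N) / (\<Prod>k=n0..<n0 + N. - a k / b k)"

definition has_C_sum :: "(nat \<Rightarrow> complex) \<Rightarrow> complex \<Rightarrow> bool" where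
  "has_C_sum s v \<longleftrightarrow>
     (\<exists>n0 a b \<mu> I. recurrence_presentation s n0 a b \<mu> \<and> recurrence_solution n0 a b \<mu> I \<and>
        MM_admissible (normalized_tail n0 a b I) \<and>
        v = a n0 * I n0 - FP_inf (normalized_tail n0 a b I))"

definition C_summable :: "(nat \<Rightarrow> complex) \<Rightarrow> bool" where
  "C_summable s \<longleftrightarrow> (\<exists>v. has_C_sum s v)"

text \<open>The definite description is legitimate only because the value does not depend on the
  presentation and the solution.\<close>

definition C_sum :: "(nat \<Rightarrow> complex) \<Rightarrow> complex" where
  "C_sum s = (THE v. has_C_sum s v)"

end

theory Submission
  imports Defs
    "HOL-Probability.Characteristic_Functions"
    "HOL-Probability.Sinc_Integral"
    "HOL-Complex_Analysis.Conformal_Mappings"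
    "HOL-Real_Asymp.Real_Asymp"
begin

text \<open>
  Whatever the presentation, the normalized tail satisfies \<open>R\<^sub>N - R\<^sub>N\<^sub>+\<^sub>1 = (-1)\<^sup>N (kN)! a\<^sup>N\<close>, so
  \<open>c(x) = e\<^sup>i\<^sup>\<pi>\<^sup>x G(x)\<close> with \<open>G(x) = a\<^sup>x \<Gamma>(kx + 1)\<close> is a candidate for the difference germ. The Euler
  integral, after the substitution \<open>u = ln (a t\<^sup>k)\<close>, exhibits \<open>G\<close> as a bilateral Laplace transform
  of some \<open>\<phi>\<close>, and Fourier inversion identifies \<open>\<phi>\<close> with the Bromwich transform of \<open>G\<close>. Undoing the
  substitution, the selector at \<open>N\<close> is \<open>(-1)\<^sup>N\<close> times the integral of
  \<open>e\<^sup>-\<^sup>t (a t\<^sup>k)\<^sup>N / (1 + a t\<^sup>k)\<close>, which satisfies the same difference equation as \<open>R\<close> from \<open>N = 0\<close> on;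
  the finite part is therefore \<open>R\<^sub>0\<close> minus the integral for \<open>N = 0\<close>.

  The definite descriptions require that \<open>c\<close> is unique. Any two growth monomials are either
  asymptotically comparable in the strict sense or equal as germs: for log-exp monomials this
  follows by induction on the height, since the logarithm of a quotient is a linear combination of
  infinite monomials of smaller height and is governed by its largest term; gamma-type germs are
  reduced to log-exp monomials by Stirling's formula. Hence a finite sum of growth monomials that
  vanishes at infinitely many integers vanishes as a germ.
\<close>

section \<open>Finite sums over an asymptotic scale\<close>

text \<open>Coefficients lie in an arbitrary normed space: real ones occur in the exponents of
  log-exp monomials, complex ones in finite sums of growth monomials.\<close>

definition lincomb :: "('i \<Rightarrow> real \<Rightarrow> real) \<Rightarrow> ('a::real_normed_vector \<times> 'i) list \<Rightarrow> real \<Rightarrow> 'a" where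
  "lincomb val l x = (\<Sum>(c, m)\<leftarrow>l. val m x *\<^sub>R c)"

lemma lincomb_Nil [simp]: "lincomb val [] x = 0"
  and lincomb_Cons [simp]: "lincomb val ((c, m) # l) x = val m x *\<^sub>R c + lincomb val l x"
  and lincomb_append [simp]: "lincomb val (l @ l') x = lincomb val l x + lincomb val l' x"
  by (simp_all add: lincomb_def)

lemma lincomb_uminus [simp]:
  "lincomb val (map (\<lambda>(c, m). (- c, m)) l) x = - lincomb val l x"
  by (induction l) auto

text \<open>The third alternative is equality of germs and not just asymptotic proportionality.
  Terms of the same size can therefore be merged without leaving a remainder.\<close>

locale asymptotic_scale =
  fixes val :: "'i \<Rightarrow> real \<Rightarrow> real" and S :: "'i set"
  assumes pos: "m \<in> S \<Longrightarrow> \<forall>\<^sub>F x in at_top. val m x > 0"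
    and comparable: "m \<in> S \<Longrightarrow> n \<in> S \<Longrightarrow>
      ((\<lambda>x. val m x / val n x) \<longlongrightarrow> 0) at_top \<or> ((\<lambda>x. val n x / val m x) \<longlongrightarrow> 0) at_top \<or>
      (\<forall>\<^sub>F x in at_top. val m x = val n x)"
begin

definition prec :: "'i \<Rightarrow> 'i \<Rightarrow> bool" where
  "prec m n \<longleftrightarrow> ((\<lambda>x. val m x / val n x) \<longlongrightarrow> 0) at_top"

definition normal_form :: "('a::real_normed_vector \<times> 'i) list \<Rightarrow> bool" where
  "normal_form l \<longleftrightarrow> (\<forall>(c, m) \<in> set l. c \<noteq> 0 \<and> m \<in> S) \<and>
     sorted_wrt (\<lambda>m n. prec n m) (map snd l)"

lemma normal_form_Cons:
  "normal_form ((c, m) # l) \<longleftrightarrow>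
     c \<noteq> 0 \<and> m \<in> S \<and> (\<forall>n \<in> snd ` set l. prec n m) \<and> normal_form l"
  by (auto simp: normal_form_def)

lemma prec_trans:
  assumes "prec m n" "prec n p" "n \<in> S" shows "prec m p"
proof -
  have "((\<lambda>x. (val m x / val n x) * (val n x / val p x)) \<longlongrightarrow> 0 * 0) at_top"
    using assms(1,2) unfolding prec_def by (intro tendsto_mult)
  moreover have "\<forall>\<^sub>F x in at_top. (val m x / val n x) * (val n x / val p x) = val m x / val p x"
    using pos[OF assms(3)] by eventually_elim auto
  ultimately show ?thesis
    unfolding prec_def using Lim_transform_eventually by fastforce
qed

lemma lincomb_tendsto_0:
  assumes "\<forall>n \<in> snd ` set l. prec n m"
  shows "((\<lambda>x. lincomb val l x /\<^sub>R val m x) \<longlongrightarrow> 0) at_top"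
  using assms
proof (induction l)
  case (Cons p l)
  obtain c n where p: "p = (c, n)" by force
  have "((\<lambda>x. (val n x / val m x) *\<^sub>R c + lincomb val l x /\<^sub>R val m x) \<longlongrightarrow> 0 *\<^sub>R c + 0) at_top"
    using Cons by (intro tendsto_add tendsto_scaleR tendsto_const) (auto simp: p prec_def)
  then show ?case by (simp add: p scaleR_add_right divide_inverse_commute)
qed simp

lemma leading_term:
  assumes "normal_form ((c, m) # l)"
  shows "((\<lambda>x. lincomb val ((c, m) # l) x /\<^sub>R val m x) \<longlongrightarrow> c) at_top"
proof -
  from assms have m: "m \<in> S" and l: "\<forall>n \<in> snd ` set l. prec n m"
    by (auto simp: normal_form_Cons)
  have "((\<lambda>x. c + lincomb val l x /\<^sub>R val m x) \<longlongrightarrow> c + 0) at_top"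
    by (intro tendsto_add tendsto_const lincomb_tendsto_0 l)
  moreover have "\<forall>\<^sub>F x in at_top.
      c + lincomb val l x /\<^sub>R val m x = lincomb val ((c, m) # l) x /\<^sub>R val m x"
    using pos[OF m] by eventually_elim (simp add: scaleR_add_right)
  ultimately show ?thesis using Lim_transform_eventually by fastforce
qed

text \<open>Insertion sort: \<open>m\<close> goes before the first smaller term, or its coefficient
  is added to that of an equal germ, where it may cancel. Controlling which monomials occur in
  \<open>l'\<close> keeps the head dominant when the insertion happens further down.\<close>

lemma normal_form_insert:
  assumes "normal_form l" "m \<in> S" "c \<noteq> 0"
  shows "\<exists>l'. normal_form l' \<and> snd ` set l' \<subseteq> insert m (snd ` set l) \<and>
           (\<forall>\<^sub>F x in at_top. lincomb val l' x = val m x *\<^sub>R c + lincomb val l x)"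
  using assms(1)
proof (induction l)
  case Nil
  then show ?case
    by (intro exI[of _ "[(c, m)]"]) (use assms in \<open>auto simp: normal_form_def\<close>)
next
  case (Cons p l)
  obtain d n where p: "p = (d, n)" by force
  have nf: "d \<noteq> 0" "n \<in> S" "\<forall>q \<in> snd ` set l. prec q n" "normal_form l"
    using Cons.prems by (auto simp: p normal_form_Cons)
  consider "prec n m" | "prec m n" | "\<forall>\<^sub>F x in at_top. val m x = val n x"
    using comparable[OF assms(2) nf(2)] by (auto simp: prec_def)
  then show ?case
  proof cases
    case 1
    with nf have "normal_form ((c, m) # p # l)"
      using assms prec_trans by (fastforce simp: p normal_form_Cons)
    then show ?thesis by (intro exI[of _ "(c, m) # p # l"]) auto
  next
    case 2
    obtain l' where l': "normal_form l'" "snd ` set l' \<subseteq> insert m (snd ` set l)"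
      "\<forall>\<^sub>F x in at_top. lincomb val l' x = val m x *\<^sub>R c + lincomb val l x"
      using Cons.IH[OF nf(4)] by auto
    have "\<forall>\<^sub>F x in at_top. lincomb val (p # l') x = val m x *\<^sub>R c + lincomb val (p # l) x"
      using l'(3) by eventually_elim (simp add: p)
    moreover have "normal_form (p # l')"
      unfolding p normal_form_Cons using 2 nf l'(1,2) by fast
    ultimately show ?thesis using l'(2) by (intro exI[of _ "p # l'"]) (auto simp: p)
  next
    case 3
    show ?thesis
    proof (cases "d + c = 0")
      case True
      have "\<forall>\<^sub>F x in at_top. lincomb val l x = val m x *\<^sub>R c + lincomb val (p # l) x"
        using 3
      proof eventually_elim
        case (elim x)
        have "val n x *\<^sub>R (d + c) = 0" using True by simp
        then show ?case using elim by (simp add: p scaleR_add_right algebra_simps)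
      qed
      then show ?thesis using nf(4) by (intro exI[of _ l]) auto
    next
      case False
      have "\<forall>\<^sub>F x in at_top. lincomb val ((d + c, n) # l) x = val m x *\<^sub>R c + lincomb val (p # l) x"
        using 3 by eventually_elim (simp add: p scaleR_add_right)
      moreover have "normal_form ((d + c, n) # l)"
        using nf False by (simp add: normal_form_Cons)
      ultimately show ?thesis by (intro exI[of _ "(d + c, n) # l"]) (auto simp: p)
    qed
  qed
qed

lemma normal_form_exists:
  assumes "snd ` set l \<subseteq> S"
  shows "\<exists>l'. normal_form l' \<and> (\<forall>\<^sub>F x in at_top. lincomb val l' x = lincomb val l x)"
  using assms
proof (induction l)
  case Nil
  then show ?case by (intro exI[of _ "[]"]) (auto simp: normal_form_def)
next
  case (Cons p l)
  obtain c m where p: "p = (c, m)" by force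
  obtain l' where l': "normal_form l'" "\<forall>\<^sub>F x in at_top. lincomb val l' x = lincomb val l x"
    using Cons by auto
  show ?case
  proof (cases "c = 0")
    case True
    then show ?thesis using l' by (auto simp: p)
  next
    case False
    obtain l'' where "normal_form l''"
      "\<forall>\<^sub>F x in at_top. lincomb val l'' x = val m x *\<^sub>R c + lincomb val l' x"
      using normal_form_insert[OF l'(1) _ False, of m] Cons.prems by (auto simp: p)
    then show ?thesis using l'(2)
      by (intro exI[of _ l'']) (auto simp: p elim: eventually_elim2)
  qed
qed

text \<open>Divided by its leading monomial, a nonempty sum tends to the leading coefficient, so it
  is eventually nonzero.\<close>

lemma normal_form_frequently_0:
  assumes "normal_form l" "\<exists>\<^sub>F x in at_top. lincomb val l x = 0"
  shows "l = []"
proof (cases l)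
  case (Cons p l')
  obtain c m where p: "p = (c, m)" by force
  have nf: "normal_form ((c, m) # l')" using assms(1) Cons p by simp
  have "\<forall>\<^sub>F x in at_top. lincomb val l x /\<^sub>R val m x \<noteq> 0"
    using leading_term[OF nf] nf
    by (intro tendsto_imp_eventually_ne) (auto simp: Cons p normal_form_Cons)
  with assms(2) have "\<exists>\<^sub>F x in at_top. lincomb val l x /\<^sub>R val m x \<noteq> 0 \<and> lincomb val l x = 0"
    by (intro frequently_eventually_conj) auto
  then show ?thesis by (auto dest: frequently_ex)
qed

text \<open>Zeros at arbitrarily large arguments suffice; in the application these are the even or
  the odd integers.\<close>

lemma lincomb_frequently_0:
  assumes "snd ` set l \<subseteq> S" "\<exists>\<^sub>F x in at_top. lincomb val l x = 0"
  shows "\<forall>\<^sub>F x in at_top. lincomb val l x = 0"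
proof -
  obtain l' where l': "normal_form l'" "\<forall>\<^sub>F x in at_top. lincomb val l' x = lincomb val l x"
    using normal_form_exists[OF assms(1)] by auto
  have "\<exists>\<^sub>F x in at_top. lincomb val l' x = 0"
    using frequently_eventually_conj[OF assms(2) l'(2)] by (rule frequently_elim1) auto
  with l'(1) have "l' = []" by (rule normal_form_frequently_0)
  with l'(2) show ?thesis by (auto elim: eventually_mono)
qed

end

section \<open>Towers of exponentials of infinite germs\<close>

text \<open>The multiplicative group generated by all real powers of \<open>exp m\<close> with
  \<open>m\<close> in \<open>S\<close>, where functions are identified if they agree
  eventually.\<close>

definition expspan :: "(real \<Rightarrow> real) set \<Rightarrow> (real \<Rightarrow> real) set" where
  "expspan S = {f. \<exists>l. snd ` set l \<subseteq> S \<and> (\<forall>\<^sub>F x in at_top. f x = exp (lincomb (\<lambda>m. m) l x))}"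

lemma expspanI:
  assumes "snd ` set l \<subseteq> S" "\<forall>\<^sub>F x in at_top. f x = exp (lincomb (\<lambda>m. m) l x)"
  shows "f \<in> expspan S"
  using assms by (auto simp: expspan_def)

lemma expspan_pos: "f \<in> expspan S \<Longrightarrow> \<forall>\<^sub>F x in at_top. f x > 0"
  by (auto simp: expspan_def elim: eventually_mono)

lemma expspan_mono: "S \<subseteq> S' \<Longrightarrow> expspan S \<subseteq> expspan S'"
  unfolding expspan_def by blast

lemma expspan_cong:
  assumes "f \<in> expspan S" "\<forall>\<^sub>F x in at_top. g x = f x" shows "g \<in> expspan S"
proof -
  from assms(1) obtain l where l: "snd ` set l \<subseteq> S"
    "\<forall>\<^sub>F x in at_top. f x = exp (lincomb (\<lambda>m. m) l x)"
    by (auto simp: expspan_def)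
  show ?thesis by (rule expspanI[OF l(1)]) (use l(2) assms(2) in eventually_elim, simp)
qed

lemma expspan_divide:
  assumes "f \<in> expspan S" "g \<in> expspan S" shows "(\<lambda>x. f x / g x) \<in> expspan S"
proof -
  from assms obtain l l' where l: "snd ` set l \<subseteq> S" "snd ` set l' \<subseteq> S"
    "\<forall>\<^sub>F x in at_top. f x = exp (lincomb (\<lambda>m. m) l x)"
    "\<forall>\<^sub>F x in at_top. g x = exp (lincomb (\<lambda>m. m) l' x)"
    by (auto simp: expspan_def)
  show ?thesis
  proof (rule expspanI[of "l @ map (\<lambda>(c, m). (- c, m)) l'"])
    show "\<forall>\<^sub>F x in at_top.
        f x / g x = exp (lincomb (\<lambda>m. m) (l @ map (\<lambda>(c, m). (- c, m)) l') x)"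
      using l(3,4) by eventually_elim (simp add: exp_diff)
  qed (use l(1,2) in force)
qed

lemma expspan_1: "(\<lambda>_. 1) \<in> expspan S"
  by (rule expspanI[of "[]"]) auto

lemma expspan_mult:
  assumes "f \<in> expspan S" "g \<in> expspan S" shows "(\<lambda>x. f x * g x) \<in> expspan S"
  using expspan_divide[OF assms(1) expspan_divide[OF expspan_1 assms(2)]] by simp

lemma expspan_exp:
  assumes "m \<in> S" shows "(\<lambda>x. exp (c * m x)) \<in> expspan S"
  by (rule expspanI[of "[(c, m)]"]) (use assms in auto)

definition infinite_scale :: "(real \<Rightarrow> real) set \<Rightarrow> bool" where
  "infinite_scale S \<longleftrightarrow> asymptotic_scale (\<lambda>m. m) S \<and> (\<forall>m\<in>S. filterlim m at_top at_top)"

text \<open>In normal form the exponent is asymptotic to its leading term \<open>c * m\<close> with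
  \<open>m\<close> tending to infinity, so the sign of \<open>c\<close> decides. An empty normal
  form gives exactly 1, which is the source of all later conclusions that germs are equal.\<close>

lemma expspan_trichotomy:
  assumes "infinite_scale S" "f \<in> expspan S"
  shows "(f \<longlongrightarrow> 0) at_top \<or> filterlim f at_top at_top \<or> (\<forall>\<^sub>F x in at_top. f x = 1)"
proof -
  interpret asymptotic_scale "\<lambda>m. m" S using assms(1) by (simp add: infinite_scale_def)
  obtain l0 where l0: "snd ` set l0 \<subseteq> S" "\<forall>\<^sub>F x in at_top. f x = exp (lincomb (\<lambda>m. m) l0 x)"
    using assms(2) by (auto simp: expspan_def)
  obtain l where l: "normal_form l"
    "\<forall>\<^sub>F x in at_top. lincomb (\<lambda>m. m) l x = lincomb (\<lambda>m. m) l0 x"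
    using normal_form_exists[OF l0(1)] by auto
  let ?F = "lincomb (\<lambda>m. m) l"
  have f: "\<forall>\<^sub>F x in at_top. f x = exp (?F x)"
    using l0(2) l(2) by eventually_elim simp
  show ?thesis
  proof (cases l)
    case Nil
    then show ?thesis using f by simp
  next
    case (Cons p l')
    obtain c m where p: "p = (c, m)" by force
    have m: "c \<noteq> 0" "m \<in> S" using l(1) by (auto simp: Cons p normal_form_Cons)
    have lim: "((\<lambda>x. ?F x / m x) \<longlongrightarrow> c) at_top"
      using leading_term[of c m l'] l(1) by (simp add: Cons p divide_inverse_commute)
    have top: "filterlim m at_top at_top" using assms(1) m(2) by (auto simp: infinite_scale_def)
    have F: "\<forall>\<^sub>F x in at_top. ?F x / m x * m x = ?F x"
      using pos[OF m(2)] by eventually_elim simp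
    show ?thesis
    proof (cases "c > 0")
      case True
      have "filterlim (\<lambda>x. ?F x / m x * m x) at_top at_top"
        by (rule filterlim_tendsto_pos_mult_at_top[OF lim True top])
      then have "filterlim ?F at_top at_top"
        using F by (simp add: filterlim_cong)
      then have "filterlim (\<lambda>x. exp (?F x)) at_top at_top"
        by (rule filterlim_compose[OF exp_at_top])
      then show ?thesis using f by (simp add: filterlim_cong)
    next
      case False
      then have "filterlim (\<lambda>x. ?F x / m x * m x) at_bot at_top"
        using m(1) by (intro filterlim_tendsto_neg_mult_at_bot[OF lim _ top]) auto
      then have "filterlim ?F at_bot at_top"
        using F by (simp add: filterlim_cong)
      then have "((\<lambda>x. exp (?F x)) \<longlongrightarrow> 0) at_top"
        by (rule filterlim_compose[OF exp_at_bot])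
      then show ?thesis using f by (simp add: tendsto_cong)
    qed
  qed
qed

lemma expspan_comparable:
  assumes "infinite_scale S" "f \<in> expspan S" "g \<in> expspan S"
  shows "((\<lambda>x. f x / g x) \<longlongrightarrow> 0) at_top \<or> ((\<lambda>x. g x / f x) \<longlongrightarrow> 0) at_top \<or>
    (\<forall>\<^sub>F x in at_top. f x = g x)"
proof -
  consider "((\<lambda>x. f x / g x) \<longlongrightarrow> 0) at_top" | "filterlim (\<lambda>x. f x / g x) at_top at_top"
    | "\<forall>\<^sub>F x in at_top. f x / g x = 1"
    using expspan_trichotomy[OF assms(1) expspan_divide[OF assms(2,3)]] by blast
  then show ?thesis
  proof cases
    case 2
    from tendsto_inverse_0_at_top[OF this] show ?thesis by simp
  next
    case 3
    have "\<forall>\<^sub>F x in at_top. f x = g x"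
      using 3 expspan_pos[OF assms(3)] by eventually_elim (simp add: field_simps)
    then show ?thesis by simp
  qed simp
qed

text \<open>A positive limit excludes both the limit 0 and divergence. Information on a limit thus
  becomes an identity of germs.\<close>

lemma expspan_tendsto_pos:
  assumes "infinite_scale S" "f \<in> expspan S" "(f \<longlongrightarrow> C) at_top" "C > 0"
  shows "\<forall>\<^sub>F x in at_top. f x = 1"
  using expspan_trichotomy[OF assms(1,2)]
proof (elim disjE)
  assume "(f \<longlongrightarrow> 0) at_top"
  from tendsto_unique[OF _ this assms(3)] assms(4) show ?thesis by simp
next
  assume "filterlim f at_top at_top"
  with not_tendsto_and_filterlim_at_infinity[OF _ assms(3)] show ?thesis
    by (simp add: filterlim_at_top_imp_at_infinity)
qed

lemma infinite_scale_step:
  assumes "infinite_scale S"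
  shows "infinite_scale {f \<in> expspan S. filterlim f at_top at_top}"
  unfolding infinite_scale_def asymptotic_scale_def
  using expspan_comparable[OF assms] by (auto dest: expspan_pos)

text \<open>Each level consists of infinite germs only, so that membership in the span of a level is
  closed under products and quotients; the logarithm of a log-exp monomial is a linear combination
  of members of the next lower level.\<close>

primrec tower :: "nat \<Rightarrow> (real \<Rightarrow> real) set" where
  "tower 0 = {iter_ln (Suc j) | j. True}"
| "tower (Suc h) = {f \<in> expspan (tower h). filterlim f at_top at_top}"

lemma iter_ln_at_top: "filterlim (iter_ln j :: real \<Rightarrow> real) at_top at_top"
proof (induction j)
  case 0
  show ?case by (simp add: filterlim_ident iter_ln_def)
next
  case (Suc j)
  from filterlim_compose[OF ln_at_top Suc] show ?case by simp
qed

lemma iter_ln_small: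
  "((\<lambda>x::real. iter_ln (i + Suc d) x / iter_ln i x) \<longlongrightarrow> 0) at_top"
proof (induction d)
  case 0
  have "((\<lambda>y::real. ln y / y) \<longlongrightarrow> 0) at_top" by real_asymp
  from filterlim_compose[OF this iter_ln_at_top] show ?case by simp
next
  case (Suc d)
  have "((\<lambda>y::real. ln y / y) \<longlongrightarrow> 0) at_top" by real_asymp
  from filterlim_compose[OF this iter_ln_at_top[of "i + Suc d"]]
  have "((\<lambda>x::real. iter_ln (i + Suc (Suc d)) x / iter_ln (i + Suc d) x) \<longlongrightarrow> 0) at_top" 
    by simp
  from tendsto_mult[OF this Suc]
  have "((\<lambda>x::real. iter_ln (i + Suc (Suc d)) x / iter_ln (i + Suc d) x *
      (iter_ln (i + Suc d) x / iter_ln i x)) \<longlongrightarrow> 0) at_top" by simp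
  moreover have "\<forall>\<^sub>F x::real in at_top. iter_ln (i + Suc (Suc d)) x / iter_ln (i + Suc d) x *
      (iter_ln (i + Suc d) x / iter_ln i x) = iter_ln (i + Suc (Suc d)) x / iter_ln i x"
    using filterlim_at_top_dense[THEN iffD1, OF iter_ln_at_top[of "i + Suc d"], rule_format, of 0]
    by eventually_elim simp
  ultimately show ?case by (rule Lim_transform_eventually)
qed

lemma infinite_scale_tower: "infinite_scale (tower h)"
proof (induction h)
  case 0
  have cmp: "((\<lambda>x::real. iter_ln i x / iter_ln j x) \<longlongrightarrow> 0) at_top \<or> 
      ((\<lambda>x::real. iter_ln j x / iter_ln i x) \<longlongrightarrow> 0) at_top \<or> i = j" for i j
  proof (cases i j rule: linorder_cases)
    case less
    then obtain d where "j = i + Suc d" using less_iff_Suc_add by auto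
    then show ?thesis using iter_ln_small by blast
  next
    case greater
    then obtain d where "i = j + Suc d" using less_iff_Suc_add by auto
    then show ?thesis using iter_ln_small by blast
  qed simp
  have pos: "\<forall>\<^sub>F x::real in at_top. iter_ln j x > 0" for j
    using iter_ln_at_top[of j] unfolding filterlim_at_top_dense by blast
  show ?case
    unfolding infinite_scale_def asymptotic_scale_def
  proof (intro conjI allI impI ballI)
    fix m n :: "real \<Rightarrow> real" assume "m \<in> tower 0" "n \<in> tower 0"
    then obtain i j where "m = iter_ln (Suc i)" "n = iter_ln (Suc j)" by auto
    then show "((\<lambda>x. m x / n x) \<longlongrightarrow> 0) at_top \<or> ((\<lambda>x. n x / m x) \<longlongrightarrow> 0) at_top \<or>
      (\<forall>\<^sub>F x in at_top. m x = n x)"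
      using cmp[of "Suc i" "Suc j"] by auto
  next
    fix m :: "real \<Rightarrow> real" assume "m \<in> tower 0"
    then obtain i where "m = iter_ln (Suc i)" by auto
    then show "\<forall>\<^sub>F x in at_top. 0 < m x" "filterlim m at_top at_top"
      using pos iter_ln_at_top by blast+
  qed
next
  case (Suc h)
  then show ?case using infinite_scale_step by simp
qed

text \<open>An iterated logarithm is the exponential of the next one, so the bottom level, which
  contains all of them from \<open>ln x\<close> on, lies in its own span. The higher levels follow
  by monotonicity.\<close>

lemma tower_Suc: "tower h \<subseteq> tower (Suc h)"
proof (induction h)
  case 0
  have "iter_ln (Suc j) \<in> expspan (tower 0)" for j
  proof (rule expspan_cong[OF expspan_exp[of "iter_ln (Suc (Suc j))" _ 1]])
    show "\<forall>\<^sub>F x::real in at_top. iter_ln (Suc j) x = exp (1 * iter_ln (Suc (Suc j)) x)"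
      using filterlim_at_top_dense[THEN iffD1, OF iter_ln_at_top[of "Suc j"], rule_format, of 0]
      by eventually_elim simp
  qed auto
  then show ?case using iter_ln_at_top by auto
next
  case (Suc h)
  then show ?case using expspan_mono[OF Suc] by auto
qed

lemma tower_mono: "h \<le> h' \<Longrightarrow> tower h \<subseteq> tower h'"
  using lift_Suc_mono_le[of tower] tower_Suc by blast

section \<open>Germs in the span of some level of the tower\<close>

definition tower_span :: "(real \<Rightarrow> real) set" where
  "tower_span = (\<Union>h. expspan (tower h))"

lemma tower_span2:
  assumes "f \<in> tower_span" "g \<in> tower_span"
  obtains h where "f \<in> expspan (tower h)" "g \<in> expspan (tower h)"
proof -
  obtain i j where ij: "f \<in> expspan (tower i)" "g \<in> expspan (tower j)"
    using assms by (auto simp: tower_span_def)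
  have "expspan (tower i) \<subseteq> expspan (tower (max i j))" "expspan (tower j) \<subseteq> expspan (tower (max i j))"
    by (intro expspan_mono tower_mono; simp)+
  then show ?thesis using ij that by blast
qed

lemma tower_span_divide:
  "f \<in> tower_span \<Longrightarrow> g \<in> tower_span \<Longrightarrow> (\<lambda>x. f x / g x) \<in> tower_span"
  unfolding tower_span_def using tower_span2[of f g] expspan_divide[of f _ g]
  by (metis UN_iff UNIV_I tower_span_def)

lemma tower_span_mult:
  "f \<in> tower_span \<Longrightarrow> g \<in> tower_span \<Longrightarrow> (\<lambda>x. f x * g x) \<in> tower_span"
  unfolding tower_span_def using tower_span2[of f g] expspan_mult[of f _ g]
  by (metis UN_iff UNIV_I tower_span_def)

lemma tower_span_pos: "f \<in> tower_span \<Longrightarrow> \<forall>\<^sub>F x in at_top. f x > 0"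
  by (auto simp: tower_span_def intro: expspan_pos)

lemma tower_span_comparable:
  assumes "f \<in> tower_span" "g \<in> tower_span"
  shows "((\<lambda>x. f x / g x) \<longlongrightarrow> 0) at_top \<or> ((\<lambda>x. g x / f x) \<longlongrightarrow> 0) at_top \<or>
    (\<forall>\<^sub>F x in at_top. f x = g x)"
  using tower_span2[OF assms] expspan_comparable[OF infinite_scale_tower] by blast

lemma tower_span_tendsto_pos:
  "f \<in> tower_span \<Longrightarrow> (f \<longlongrightarrow> C) at_top \<Longrightarrow> C > 0 \<Longrightarrow> \<forall>\<^sub>F x in at_top. f x = 1"
  by (auto simp: tower_span_def intro: expspan_tendsto_pos[OF infinite_scale_tower])

lemma tower_span_exp:
  assumes "m \<in> tower_span" "filterlim m at_top at_top"
  shows "(\<lambda>x. exp (c * m x)) \<in> tower_span"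
proof -
  from assms obtain h where "m \<in> tower (Suc h)" by (auto simp: tower_span_def)
  then show ?thesis unfolding tower_span_def by (blast intro: expspan_exp)
qed

section \<open>Log-exp monomials inside the tower\<close>

lemma iter_ln_in_tower: "iter_ln (Suc j) \<in> tower h"
  using tower_mono[of 0 h] by auto

lemma pow_log_in_expspan: "pow_log \<alpha>s \<in> expspan (tower h)"
proof (rule expspanI)
  \<comment> \<open>A power of \<open>iter_ln j\<close> with exponent \<alpha> is the exponential of
    \<alpha> times \<open>iter_ln (Suc j)\<close>; hence the shifted index.\<close>
  let ?l = "map (\<lambda>j. (\<alpha>s ! j, iter_ln (Suc j))) [0..<length \<alpha>s]"
  show "snd ` set ?l \<subseteq> tower h" using iter_ln_in_tower by auto
  have "\<forall>\<^sub>F x::real in at_top. \<forall>j\<in>{..<length \<alpha>s}. iter_ln j x > 0"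
    using iter_ln_at_top unfolding filterlim_at_top_dense by (intro eventually_ball_finite) auto
  then show "\<forall>\<^sub>F x in at_top. pow_log \<alpha>s x = exp (lincomb (\<lambda>m. m) ?l x)"
  proof eventually_elim
    case (elim x)
    have "lincomb (\<lambda>m. m) ?l x = (\<Sum>j\<leftarrow>[0..<length \<alpha>s]. iter_ln (Suc j) x * \<alpha>s ! j)"
      by (simp add: lincomb_def o_def)
    also have "\<dots> = (\<Sum>j<length \<alpha>s. iter_ln (Suc j) x * \<alpha>s ! j)"
      by (simp add: interv_sum_list_conv_sum_set_nat lessThan_atLeast0)
    finally show ?case
      using elim by (force simp: exp_sum pow_log_def powr_def mult.commute intro!: prod.cong)
  qed
qed

text \<open>By induction the monomials of a reduced exponent lie in the span of
  \<open>tower h\<close>. They tend to infinity, so they are members of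
  \<open>tower (Suc h)\<close>, and the exponential of their combination lies in its span.\<close>

lemma lx_eval_in_expspan:
  "L \<in> LE_upto h \<Longrightarrow> (lx_eval L :: real \<Rightarrow> real) \<in> expspan (tower h)"
proof (induction h arbitrary: L)
  case 0
  then obtain \<alpha>s where L: "L = LogExp [] \<alpha>s" by auto
  show ?case
    by (rule expspan_cong[OF pow_log_in_expspan[of \<alpha>s]]) (simp add: L)
next
  case (Suc h)
  show ?case
  proof (cases "L \<in> LE_upto h")
    case True
    then show ?thesis using Suc.IH[OF True] expspan_mono[OF tower_Suc] by blast
  next
    case False
    then obtain \<Phi> \<alpha>s where L: "L = LogExp \<Phi> \<alpha>s" "reduced_exponent (LE_upto h) \<Phi>"
      using Suc.prems by auto
    let ?l = "map (\<lambda>(c, M). (c, lx_eval M)) \<Phi>"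
    have l: "snd ` set ?l \<subseteq> tower (Suc h)"
      using L(2) Suc.IH by (fastforce simp: reduced_exponent_def)
    have eq: "(\<Sum>(c, M)\<leftarrow>\<Phi>. c * lx_eval M x) = lincomb (\<lambda>m. m) ?l x" for x
      by (simp add: lincomb_def o_def split_def mult.commute)
    have "(\<lambda>x. exp (lincomb (\<lambda>m. m) ?l x)) \<in> expspan (tower (Suc h))"
      by (rule expspanI[OF l]) simp
    from expspan_mult[OF this pow_log_in_expspan[of \<alpha>s "Suc h"]]
    show ?thesis by (rule expspan_cong) (simp add: L eq)
  qed
qed

lemma lx_eval_in_tower_span: "L \<in> LE \<Longrightarrow> lx_eval L \<in> tower_span"
  using lx_eval_in_expspan by (auto simp: LE_def tower_span_def)

section \<open>Stirling's formula up to a constant factor\<close>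

lemma ln_Gamma_plus1:
  assumes "x > (0::real)" shows "ln_Gamma (x + 1) = ln x + ln_Gamma x"
proof -
  have "x \<notin> \<int>\<^sub>\<le>\<^sub>0" using assms by auto
  from Gamma_plus1[OF this] show ?thesis
    using assms by (simp add: ln_Gamma_real_pos ln_mult_pos)
qed

text \<open>The increment of \<open>ln_Gamma\<close> over the interval from \<open>x\<close> to
  \<open>x + 1\<close> is \<open>ln x\<close>, so \<open>ln x\<close> is a value of
  \<open>Digamma\<close> inside it. Monotonicity of \<open>Digamma\<close> then gives both
  bounds.\<close>

lemma Digamma_ln_bounds:
  assumes "x > (0::real)"
  shows "Digamma x \<le> ln x" "ln x \<le> Digamma x + 1 / x"
proof -
  have "\<exists>z. x < z \<and> z < x + 1 \<and> ln_Gamma (x + 1) - ln_Gamma x = (x + 1 - x) * Digamma z"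
    by (rule MVT2) (use assms in \<open>auto intro!: has_field_derivative_ln_Gamma_real\<close>)
  then obtain z where z: "x < z" "z < x + 1" "ln_Gamma (x + 1) - ln_Gamma x = Digamma z"
    by auto
  have "ln_Gamma (x + 1) - ln_Gamma x = ln x"
    using assms by (simp add: ln_Gamma_plus1)
  with z(3) have "ln x = Digamma z" by simp
  moreover have "Digamma x \<le> Digamma z" "Digamma z \<le> Digamma (x + 1)"
    using assms z by (auto intro!: Digamma_real_mono)
  moreover have "Digamma (x + 1) = Digamma x + 1 / x"
    using assms by (intro Digamma_plus1) auto
  ultimately show "Digamma x \<le> ln x" "ln x \<le> Digamma x + 1 / x" by auto
qed

text \<open>The remainder of Stirling's formula for \<open>ln_Gamma\<close> with the constant term
  included in it. Any finite limit will do, since only the order of growth up to a factor is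
  wanted.\<close>

definition stirling_error :: "real \<Rightarrow> real" where
  "stirling_error x = ln_Gamma x - ((x - 1/2) * ln x - x)"

text \<open>The derivative \<open>Digamma z - ln z + 1 / (2 * z)\<close> is at most
  \<open>1 / (2 * z)\<close> in absolute value by the bounds on \<open>Digamma\<close>; the mean
  value theorem does the rest.\<close>

lemma stirling_error_dist:
  assumes "0 < y" "y \<le> x"
  shows "\<bar>stirling_error x - stirling_error y\<bar> \<le> (x - y) / (2 * y)"
proof (cases "y = x")
  case False
  have "\<exists>z. y < z \<and> z < x \<and> stirling_error x - stirling_error y =
      (x - y) * (Digamma z - ln z + 1 / (2 * z))"
    unfolding stirling_error_def
    by (rule MVT2) (use assms False in \<open>auto intro!: derivative_eq_intros simp: field_simps\<close>)
  then obtain z where z: "y < z" "z < x"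
    "stirling_error x - stirling_error y = (x - y) * (Digamma z - ln z + 1 / (2 * z))"
    by auto
  have "\<bar>Digamma z - ln z + 1 / (2 * z)\<bar> \<le> 1 / (2 * z)"
    using Digamma_ln_bounds[of z] assms z by (auto simp: abs_le_iff field_simps)
  also have "\<dots> \<le> 1 / (2 * y)" using assms z by (simp add: field_simps)
  finally have "(x - y) * \<bar>Digamma z - ln z + 1 / (2 * z)\<bar> \<le> (x - y) * (1 / (2 * y))"
    using assms by (intro mult_left_mono) auto
  then show ?thesis using z(3) assms by (simp add: abs_mult)
qed simp

text \<open>Along the integers the increments are of order \<open>1 / n ^ 2\<close>, so the
  telescoping series converges. The distance estimate shows that a real argument and its integer
  part give values differing by at most \<open>1 / (x - 1)\<close>.\<close>

lemma stirling_error_convergent: "\<exists>c. (stirling_error \<longlongrightarrow> c) at_top"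
proof -
  define f where "f n = stirling_error (real n)" for n
  have diff: "f (Suc n) - f n = 1 - (real n + 1/2) * ln (1 + 1 / real n)" if "n > 0" for n
  proof -
    have "ln_Gamma (real n + 1) = ln (real n) + ln_Gamma (real n)"
      using that by (simp add: ln_Gamma_plus1)
    moreover have "ln (real n + 1) = ln (real n) + ln (1 + 1 / real n)"
    proof -
      have "real n + 1 = real n * (1 + 1 / real n)" using that by (simp add: field_simps)
      then show ?thesis using that by (simp only:) (subst ln_mult_pos, auto simp: add_pos_nonneg)
    qed
    ultimately show ?thesis using that
      by (simp add: f_def stirling_error_def algebra_simps)
  qed
  have "summable (\<lambda>n. 1 - (real n + 1/2) * ln (1 + 1 / real n))"
    by (rule summable_comparison_test_bigo[of "\<lambda>n. 1 / real n ^ 2"])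
      (simp_all add: inverse_power_summable[of 2, unfolded inverse_eq_divide], real_asymp)
  moreover have "\<forall>\<^sub>F n in sequentially. f (Suc n) - f n = 1 - (real n + 1/2) * ln (1 + 1 / real n)"
    using eventually_gt_at_top[of 0] by eventually_elim (rule diff)
  ultimately have "summable (\<lambda>n. f (Suc n) - f n)" by (simp add: summable_cong)
  then have "(\<lambda>n. (\<Sum>i<n. f (Suc i) - f i) + f 0) \<longlonglongrightarrow> (\<Sum>n. f (Suc n) - f n) + f 0"
    by (intro tendsto_add summable_LIMSEQ tendsto_const)
  then obtain c where c: "f \<longlonglongrightarrow> c" by (auto simp: sum_lessThan_telescope)
  have fl: "filterlim (\<lambda>x::real. nat \<lfloor>x\<rfloor>) sequentially at_top"
    by (intro filterlim_compose[OF filterlim_nat_sequentially filterlim_floor_sequentially])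
  have "((\<lambda>x. stirling_error x - f (nat \<lfloor>x\<rfloor>)) \<longlongrightarrow> 0) at_top"
  proof (rule Lim_null_comparison)
    show "\<forall>\<^sub>F x in at_top. norm (stirling_error x - f (nat \<lfloor>x\<rfloor>)) \<le> 1 / (x - 1)"
      using eventually_gt_at_top[of 1]
    proof eventually_elim
      case (elim x)
      define y where "y = real (nat \<lfloor>x\<rfloor>)"
      have y: "1 \<le> y \<and> y \<le> x \<and> x < y + 1"
      proof -
        have "\<lfloor>x\<rfloor> \<ge> 1" using elim by simp
        then have "y = of_int \<lfloor>x\<rfloor>" by (simp add: y_def)
        then show ?thesis using \<open>\<lfloor>x\<rfloor> \<ge> 1\<close> by linarith
      qed
      have "\<bar>stirling_error x - stirling_error y\<bar> \<le> (x - y) / (2 * y)"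
        using y by (intro stirling_error_dist) auto
      also have "\<dots> \<le> 1 / (x - 1)" using y elim
        by (intro frac_le) auto
      finally show ?case by (simp add: f_def y_def)
    qed
    show "((\<lambda>x::real. 1 / (x - 1)) \<longlongrightarrow> 0) at_top" by real_asymp
  qed
  from tendsto_add[OF this filterlim_compose[OF c fl]] show ?thesis by auto
qed

section \<open>Comparability of growth monomials\<close>

lemma iter_ln_in_tower_span: "iter_ln j \<in> tower_span"
proof (cases j)
  case 0
  have "(\<lambda>x. exp (1 * iter_ln (Suc 0) x)) \<in> expspan (tower 0)"
    by (rule expspan_exp[OF iter_ln_in_tower])
  moreover have "\<forall>\<^sub>F x::real in at_top. iter_ln j x = exp (1 * iter_ln (Suc 0) x)"
    using eventually_gt_at_top[of 0] by eventually_elim (simp add: 0)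
  ultimately have "iter_ln j \<in> expspan (tower 0)" by (rule expspan_cong)
  then show ?thesis unfolding tower_span_def by blast
next
  case (Suc i)
  have "iter_ln j \<in> expspan (tower 0)"
    using iter_ln_in_tower[of i "Suc 0"] unfolding Suc tower.simps(2) by blast
  then show ?thesis unfolding tower_span_def by blast
qed

text \<open>Stirling's main terms for \<open>Gamma (\<kappa> * x + 1)\<close> without the constant
  factor, written as a product of exponentials of multiples of \<open>x * ln x\<close>,
  \<open>x\<close> and \<open>ln x\<close>. These germs are infinite, so every factor lies in the
  span of the tower.\<close>

definition gamma_approx :: "real \<Rightarrow> logexp \<Rightarrow> real \<Rightarrow> real \<Rightarrow> real" where
  "gamma_approx \<theta> H \<kappa> x = exp (\<kappa> * (x * ln x)) * exp ((\<kappa> * ln \<kappa> - \<kappa> + \<theta>) * x) *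
     exp (1/2 * ln x) * lx_eval H x"

lemma gamma_approx_in_tower_span:
  assumes "H \<in> LE" shows "gamma_approx \<theta> H \<kappa> \<in> tower_span"
proof -
  have x: "(\<lambda>x. x) \<in> tower_span" and ln: "(\<lambda>x. ln x) \<in> tower_span"
    using iter_ln_in_tower_span[of 0] iter_ln_in_tower_span[of "Suc 0"]
    by (simp_all add: iter_ln_def)
  have "filterlim (\<lambda>x::real. x * ln x) at_top at_top" "filterlim (\<lambda>x::real. x) at_top at_top"
    "filterlim (\<lambda>x::real. ln x) at_top at_top"
    by real_asymp+
  then show ?thesis unfolding gamma_approx_def
    by (intro tower_span_mult tower_span_exp lx_eval_in_tower_span x ln assms)
qed

lemma gamma_germ_asymp:
  assumes "H \<in> LE" "\<kappa> > 0"
  shows "\<exists>C>0. ((\<lambda>x::real. gamma_germ \<theta> H \<kappa> x / gamma_approx \<theta> H \<kappa> x) \<longlongrightarrow> C) at_top"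
proof -
  obtain c where c: "(stirling_error \<longlongrightarrow> c) at_top" using stirling_error_convergent by auto
  have top: "filterlim (\<lambda>x. \<kappa> * x) at_top at_top" using assms(2) by real_asymp
  have lim: "((\<lambda>x. sqrt \<kappa> * exp (stirling_error (\<kappa> * x))) \<longlongrightarrow> sqrt \<kappa> * exp c) at_top"
    by (intro tendsto_intros filterlim_compose[OF c top])
  have "\<forall>\<^sub>F x in at_top. sqrt \<kappa> * exp (stirling_error (\<kappa> * x)) =
      gamma_germ \<theta> H \<kappa> x / gamma_approx \<theta> H \<kappa> x"
    using eventually_gt_at_top[of 0] tower_span_pos[OF lx_eval_in_tower_span[OF assms(1)]]
  proof eventually_elim
    case (elim x)
    have pos: "\<kappa> * x > 0" using elim assms by simp
    then have "Gamma (\<kappa> * x + 1) = exp (ln_Gamma (\<kappa> * x + 1))"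
      by (simp add: ln_Gamma_real_pos)
    also have "ln_Gamma (\<kappa> * x + 1) = stirling_error (\<kappa> * x) +
        ((\<kappa> * x + 1/2) * (ln \<kappa> + ln x) - \<kappa> * x)"
      using elim assms ln_Gamma_plus1[OF pos]
      by (simp add: stirling_error_def ln_mult_pos algebra_simps)
    finally have "Gamma (\<kappa> * x + 1) = exp (1/2 * ln \<kappa>) * exp (stirling_error (\<kappa> * x)) *
        (exp (\<kappa> * (x * ln x)) * exp ((\<kappa> * ln \<kappa> - \<kappa>) * x) * exp (1/2 * ln x))"
      by (simp add: exp_add[symmetric] algebra_simps)
    moreover have "exp (1/2 * ln \<kappa>) = sqrt \<kappa>"
      using assms by (simp add: powr_half_sqrt[symmetric] powr_def)
    moreover have "exp ((\<kappa> * ln \<kappa> - \<kappa> + \<theta>) * x) = exp ((\<kappa> * ln \<kappa> - \<kappa>) * x) * exp (\<theta> * x)"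
      by (simp add: exp_add[symmetric] algebra_simps)
    ultimately show ?case using elim by (simp add: gamma_germ_def gamma_approx_def)
  qed
  from Lim_transform_eventually[OF lim this] show ?thesis
    using assms by (intro exI[of _ "sqrt \<kappa> * exp c"]) simp
qed

lemma growth_monomial_asymp:
  assumes "M \<in> growth_monomials"
  shows "\<exists>e\<in>tower_span. \<exists>C>0. ((\<lambda>x::real. gm_eval M x / e x) \<longlongrightarrow> C) at_top"
proof (cases M)
  case (Pure L)
  then have L: "lx_eval L \<in> tower_span"
    using assms lx_eval_in_tower_span by (auto simp: growth_monomials_def)
  have "\<forall>\<^sub>F x::real in at_top. 1 = gm_eval M x / lx_eval L x"
    using tower_span_pos[OF L] by eventually_elim (simp add: Pure)
  then have "((\<lambda>x::real. gm_eval M x / lx_eval L x) \<longlongrightarrow> 1) at_top"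
    by (rule Lim_transform_eventually[OF tendsto_const])
  with L show ?thesis by (intro bexI[of _ "lx_eval L"] exI[of _ 1]) auto
next
  case (GammaType \<theta> H \<kappa>)
  then have "H \<in> LE" "\<kappa> > 0"
    using assms by (auto simp: growth_monomials_def LE_subexp_def)
  from gamma_germ_asymp[OF this] gamma_approx_in_tower_span[OF this(1)] show ?thesis
    unfolding GammaType gm_eval.simps by blast
qed

section \<open>Rigidity: a positive limit of a quotient forces equality of germs\<close>

lemma tendsto_quotient:
  fixes f g e d :: "real \<Rightarrow> real"
  assumes "((\<lambda>x. f x / e x) \<longlongrightarrow> A) F" "((\<lambda>x. g x / d x) \<longlongrightarrow> B) F" "B \<noteq> 0"
    and "((\<lambda>x. e x / d x) \<longlongrightarrow> D) F" "\<forall>\<^sub>F x in F. e x \<noteq> 0" "\<forall>\<^sub>F x in F. d x \<noteq> 0"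
  shows "((\<lambda>x. f x / g x) \<longlongrightarrow> A * D / B) F"
proof -
  have "((\<lambda>x. (f x / e x) * (e x / d x) / (g x / d x)) \<longlongrightarrow> A * D / B) F"
    by (intro tendsto_intros assms)
  moreover have "\<forall>\<^sub>F x in F. (f x / e x) * (e x / d x) / (g x / d x) = f x / g x"
    using assms(5,6) by eventually_elim (simp add: field_simps)
  ultimately show ?thesis by (rule Lim_transform_eventually)
qed

text \<open>The approximants inherit a positive limit of their quotient, and being in the span of
  the tower they are then equal as germs. In their logarithms \<kappa> is read off at the scale
  \<open>x * ln x\<close> and then \<theta> at the scale \<open>x\<close>, because the logarithms of
  \<open>H\<close> and \<open>H'\<close> are o(x). Cancelling the common factors leaves the equality
  of \<open>H\<close> and \<open>H'\<close>.\<close>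

lemma gamma_germ_similar:
  assumes H: "H \<in> LE_subexp" "\<kappa> > 0" and H': "H' \<in> LE_subexp" "\<kappa>' > 0"
    and lim: "((\<lambda>x::real. gamma_germ \<theta> H \<kappa> x / gamma_germ \<theta>' H' \<kappa>' x) \<longlongrightarrow> C) at_top" "C > 0"
  shows "\<kappa> = \<kappa>' \<and> \<theta> = \<theta>' \<and> (\<forall>\<^sub>F x::real in at_top. lx_eval H x = lx_eval H' x)"
proof -
  let ?e = "gamma_approx \<theta> H \<kappa>" and ?e' = "gamma_approx \<theta>' H' \<kappa>'"
  have LE: "H \<in> LE" "H' \<in> LE" using H H' by (auto simp: LE_subexp_def)
  have e: "?e \<in> tower_span" "?e' \<in> tower_span" by (intro gamma_approx_in_tower_span LE)+
  have Hpos: "\<forall>\<^sub>F x::real in at_top. lx_eval H x > 0" "\<forall>\<^sub>F x::real in at_top. lx_eval H' x > 0"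
    by (intro tower_span_pos lx_eval_in_tower_span LE)+
  have ne: "\<forall>\<^sub>F x in at_top. gamma_germ \<theta> G k x \<noteq> (0::real)" if G: "G \<in> LE" "k > 0" for G \<theta> k
  proof -
    obtain C where "C > 0" "((\<lambda>x::real. gamma_germ \<theta> G k x / gamma_approx \<theta> G k x) \<longlongrightarrow> C) at_top"
      using gamma_germ_asymp[OF G] by blast
    then have "\<forall>\<^sub>F x::real in at_top. gamma_germ \<theta> G k x / gamma_approx \<theta> G k x \<noteq> 0"
      by (intro tendsto_imp_eventually_ne) auto
    then show ?thesis by eventually_elim auto
  qed
  obtain A where A: "A > 0" "((\<lambda>x::real. gamma_germ \<theta> H \<kappa> x / ?e x) \<longlongrightarrow> A) at_top"
    using gamma_germ_asymp[OF LE(1) H(2)] by blast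
  obtain B where B: "B > 0" "((\<lambda>x::real. gamma_germ \<theta>' H' \<kappa>' x / ?e' x) \<longlongrightarrow> B) at_top"
    using gamma_germ_asymp[OF LE(2) H'(2)] by blast
  have A': "((\<lambda>x. ?e x / gamma_germ \<theta> H \<kappa> x) \<longlongrightarrow> inverse A) at_top"
    using tendsto_inverse[OF A(2)] A(1) by simp
  have B': "((\<lambda>x. ?e' x / gamma_germ \<theta>' H' \<kappa>' x) \<longlongrightarrow> inverse B) at_top"
    using tendsto_inverse[OF B(2)] B(1) by simp
  have "((\<lambda>x. ?e x / ?e' x) \<longlongrightarrow> inverse A * C / inverse B) at_top"
    by (rule tendsto_quotient[OF A' B' _ lim(1)]) (use B ne LE H H' in auto)
  from tower_span_tendsto_pos[OF tower_span_divide[OF e] this]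
  have "\<forall>\<^sub>F x in at_top. ?e x / ?e' x = 1" using A B lim by simp
  then have eq: "\<forall>\<^sub>F x in at_top. ?e x = ?e' x"
    using tower_span_pos[OF e(2)] by eventually_elim (simp add: field_simps)
  define L where "L \<theta> H \<kappa> x = \<kappa> * (x * ln x) + (\<kappa> * ln \<kappa> - \<kappa> + \<theta>) * x + 1/2 * ln x + ln (lx_eval H x)"
    for \<theta> H \<kappa> and x :: real
  have Leq: "\<forall>\<^sub>F x in at_top. L \<theta> H \<kappa> x = L \<theta>' H' \<kappa>' x"
    using eq Hpos
  proof eventually_elim
    case (elim x)
    then have "ln (?e x) = ln (?e' x)" by simp
    then show ?case using elim by (simp add: gamma_approx_def L_def ln_mult)
  qed
  have o: "((\<lambda>x::real. ln (lx_eval G x) / x) \<longlongrightarrow> 0) at_top" if "G \<in> LE_subexp" for G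
  proof -
    have "(\<lambda>x::real. ln (lx_eval G x)) \<in> o[at_top](\<lambda>x. x)"
      using that by (simp add: LE_subexp_def)
    then show ?thesis by (rule smalloD_tendsto)
  qed
  have lim1: "((\<lambda>x. L \<theta> G \<kappa> x / (x * ln x)) \<longlongrightarrow> \<kappa>) at_top" if "G \<in> LE_subexp" for G \<theta> \<kappa>
  proof -
    have "((\<lambda>x::real. \<kappa> + (\<kappa> * ln \<kappa> - \<kappa> + \<theta>) / ln x + 1 / (2 * x) +
        (ln (lx_eval G x) / x) * (1 / ln x)) \<longlongrightarrow> \<kappa> + 0 + 0 + 0 * 0) at_top"
      by (intro tendsto_add tendsto_mult o that tendsto_const; real_asymp)
    moreover have "\<forall>\<^sub>F x::real in at_top. \<kappa> + (\<kappa> * ln \<kappa> - \<kappa> + \<theta>) / ln x + 1 / (2 * x) +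
        (ln (lx_eval G x) / x) * (1 / ln x) = L \<theta> G \<kappa> x / (x * ln x)"
      using eventually_gt_at_top[of 1] by eventually_elim (simp add: L_def field_simps)
    ultimately show ?thesis using Lim_transform_eventually by fastforce
  qed
  have \<kappa>: "\<kappa> = \<kappa>'"
  proof (rule tendsto_unique[OF _ lim1[OF H(1), of \<theta> \<kappa>]])
    show "((\<lambda>x. L \<theta> H \<kappa> x / (x * ln x)) \<longlongrightarrow> \<kappa>') at_top"
      by (rule Lim_transform_eventually[OF lim1[OF H'(1), of \<theta>' \<kappa>']]) 
        (use Leq in eventually_elim, simp)
  qed simp
  have lim2: "((\<lambda>x. (L \<theta> G \<kappa> x - \<kappa> * (x * ln x)) / x - (\<kappa> * ln \<kappa> - \<kappa>)) \<longlongrightarrow> \<theta>) at_top"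
    if "G \<in> LE_subexp" for G \<theta>
  proof -
    have "((\<lambda>x::real. \<theta> + 1/2 * (ln x / x) + ln (lx_eval G x) / x) \<longlongrightarrow> \<theta> + 0 + 0) at_top"
      by (intro tendsto_add o that tendsto_const; real_asymp)
    moreover have "\<forall>\<^sub>F x::real in at_top. \<theta> + 1/2 * (ln x / x) + ln (lx_eval G x) / x =
        (L \<theta> G \<kappa> x - \<kappa> * (x * ln x)) / x - (\<kappa> * ln \<kappa> - \<kappa>)"
      using eventually_gt_at_top[of 1] by eventually_elim (simp add: L_def field_simps)
    ultimately show ?thesis using Lim_transform_eventually by fastforce
  qed
  have \<theta>: "\<theta> = \<theta>'"
  proof (rule tendsto_unique[OF _ lim2[OF H(1), of \<theta>]])
    show "((\<lambda>x. (L \<theta> H \<kappa> x - \<kappa> * (x * ln x)) / x - (\<kappa> * ln \<kappa> - \<kappa>)) \<longlongrightarrow> \<theta>') at_top"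
      by (rule Lim_transform_eventually[OF lim2[OF H'(1), of \<theta>']]) 
        (use Leq in eventually_elim, simp add: \<kappa>)
  qed simp
  have "\<forall>\<^sub>F x::real in at_top. lx_eval H x = lx_eval H' x"
    using eq by eventually_elim (simp add: gamma_approx_def \<kappa> \<theta>)
  with \<kappa> \<theta> show ?thesis by simp
qed

lemma gamma_resonantI:
  assumes "H \<in> LE_subexp" "\<kappa> > 0" "C > 0"
    and "((\<lambda>x::real. lx_eval L x / gamma_germ \<theta> H \<kappa> x) \<longlongrightarrow> C) at_top"
  shows "gamma_resonant L"
  using assms unfolding gamma_resonant_def by blast

text \<open>Excluding gamma-resonant pure monomials is exactly what rules out the two mixed cases.\<close>

lemma growth_monomials_similar:
  assumes M: "M \<in> growth_monomials" and M': "M' \<in> growth_monomials"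
    and lim: "((\<lambda>x::real. gm_eval M x / gm_eval M' x) \<longlongrightarrow> C) at_top" "C > 0"
  shows "(\<forall>\<^sub>F x::real in at_top. gm_eval M x = gm_eval M' x) \<and>
    (case (M, M') of (Pure L, Pure L') \<Rightarrow> True
      | (GammaType \<theta> H \<kappa>, GammaType \<theta>' H' \<kappa>') \<Rightarrow> \<kappa> = \<kappa>' \<and> \<theta> = \<theta>' \<and>
          (\<forall>\<^sub>F x::real in at_top. lx_eval H x = lx_eval H' x)
      | _ \<Rightarrow> False)"
proof (cases M; cases M')
  fix L L' assume MM: "M = Pure L" "M' = Pure L'"
  then have L: "lx_eval L \<in> tower_span" "lx_eval L' \<in> tower_span"
    using M M' lx_eval_in_tower_span by (auto simp: growth_monomials_def)
  have "\<forall>\<^sub>F x in at_top. lx_eval L x / lx_eval L' x = (1::real)"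
    by (rule tower_span_tendsto_pos[OF tower_span_divide[OF L] _ lim(2)]) (use lim MM in simp)
  then have "\<forall>\<^sub>F x in at_top. lx_eval L x = (lx_eval L' x :: real)"
    using tower_span_pos[OF L(2)] by eventually_elim (simp add: field_simps)
  then show ?thesis using MM by simp
next
  fix L \<theta> H \<kappa> assume "M = Pure L" "M' = GammaType \<theta> H \<kappa>"
  then have "gamma_resonant L" "\<not> gamma_resonant L"
    using M M' lim by (auto simp: growth_monomials_def intro: gamma_resonantI)
  then show ?thesis by simp
next
  fix L \<theta> H \<kappa> assume "M = GammaType \<theta> H \<kappa>" "M' = Pure L"
  moreover have "((\<lambda>x::real. gm_eval M' x / gm_eval M x) \<longlongrightarrow> inverse C) at_top"
    using tendsto_inverse[OF lim(1)] lim(2) by simp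
  ultimately have "gamma_resonant L" "\<not> gamma_resonant L"
    using M M' positive_imp_inverse_positive[OF lim(2)] gamma_resonantI[of H \<kappa> "inverse C" L \<theta>]
    by (auto simp: growth_monomials_def)
  then show ?thesis by simp
next
  fix \<theta> H \<kappa> \<theta>' H' \<kappa>' assume MM: "M = GammaType \<theta> H \<kappa>" "M' = GammaType \<theta>' H' \<kappa>'"
  have *: "\<kappa> = \<kappa>' \<and> \<theta> = \<theta>' \<and> (\<forall>\<^sub>F x::real in at_top. lx_eval H x = lx_eval H' x)"
    by (rule gamma_germ_similar[OF _ _ _ _ _ lim(2)])
      (use M M' lim(1) MM in \<open>auto simp: growth_monomials_def\<close>)
  then have "\<forall>\<^sub>F x::real in at_top. gm_eval M x = gm_eval M' x"
    by (auto simp: MM gamma_germ_def elim: eventually_mono)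
  with * MM show ?thesis by simp
qed

text \<open>Each growth monomial is, up to a positive constant, asymptotic to a germ in the span of
  the tower, where comparability is known. If two such germs coincide, the quotient of the monomials
  has a positive limit, and rigidity turns this into equality.\<close>

interpretation gm: asymptotic_scale gm_eval growth_monomials
proof
  fix M assume M: "M \<in> growth_monomials"
  obtain e C where e: "e \<in> tower_span" "C > 0" "((\<lambda>x::real. gm_eval M x / e x) \<longlongrightarrow> C) at_top"
    using growth_monomial_asymp[OF M] by blast
  have "\<forall>\<^sub>F x::real in at_top. gm_eval M x / e x > 0" using order_tendstoD(1)[OF e(3,2)] .
  then show "\<forall>\<^sub>F x::real in at_top. gm_eval M x > 0"
    using tower_span_pos[OF e(1)] by eventually_elim (simp add: zero_less_divide_iff)
next
  fix M M' assume M: "M \<in> growth_monomials" and M': "M' \<in> growth_monomials"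
  obtain e C where e: "e \<in> tower_span" "C > 0" "((\<lambda>x::real. gm_eval M x / e x) \<longlongrightarrow> C) at_top"
    using growth_monomial_asymp[OF M] by blast
  obtain d B where d: "d \<in> tower_span" "B > 0" "((\<lambda>x::real. gm_eval M' x / d x) \<longlongrightarrow> B) at_top"
    using growth_monomial_asymp[OF M'] by blast
  have ne: "\<forall>\<^sub>F x in at_top. e x \<noteq> 0" "\<forall>\<^sub>F x in at_top. d x \<noteq> 0"
    using tower_span_pos[OF e(1)] tower_span_pos[OF d(1)] by (auto elim: eventually_mono)
  consider "((\<lambda>x. e x / d x) \<longlongrightarrow> 0) at_top" | "((\<lambda>x. d x / e x) \<longlongrightarrow> 0) at_top"
    | "\<forall>\<^sub>F x in at_top. e x = d x"
    using tower_span_comparable[OF e(1) d(1)] by blast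
  then show "((\<lambda>x::real. gm_eval M x / gm_eval M' x) \<longlongrightarrow> 0) at_top \<or>
      ((\<lambda>x::real. gm_eval M' x / gm_eval M x) \<longlongrightarrow> 0) at_top \<or>
      (\<forall>\<^sub>F x::real in at_top. gm_eval M x = gm_eval M' x)"
  proof cases
    case 1
    from tendsto_quotient[OF e(3) d(3) _ 1 ne] d(2) show ?thesis by simp
  next
    case 2
    from tendsto_quotient[OF d(3) e(3) _ 2 ne(2,1)] e(2) show ?thesis by simp
  next
    case 3
    have "\<forall>\<^sub>F x in at_top. 1 = e x / d x" using 3 ne by eventually_elim simp
    from Lim_transform_eventually[OF tendsto_const this]
    have lim: "((\<lambda>x. e x / d x) \<longlongrightarrow> 1) at_top" .
    have "((\<lambda>x::real. gm_eval M x / gm_eval M' x) \<longlongrightarrow> C * 1 / B) at_top"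
      by (rule tendsto_quotient[OF e(3) d(3) _ lim ne]) (use d in simp)
    from growth_monomials_similar[OF M M' this] e d show ?thesis by auto
  qed
qed

section \<open>Continuation of log-exp monomials to half-planes\<close>

text \<open>The real part of \<open>ln w\<close> is \<open>ln (norm w)\<close>, so a lower bound
  \<open>exp K\<close> for the real part of \<open>w\<close> yields \<open>K\<close> for the next
  logarithm. This is why \<open>K\<close> varies in the induction. With \<open>K = 0\<close> the
  iterated logarithms stay off the branch cut.\<close>

lemma iter_ln_Re_gt:
  "\<forall>\<^sub>F \<sigma> in at_top. \<forall>z::complex. Re z > \<sigma> \<longrightarrow> Re (iter_ln j z) > K"
proof (induction j arbitrary: K)
  case 0
  show ?case using eventually_ge_at_top[of K] by eventually_elim auto
next
  case (Suc j)
  from Suc[of "exp K"] show ?case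
  proof eventually_elim
    case (elim \<sigma>)
    show ?case
    proof (intro allI impI)
      fix z :: complex assume "Re z > \<sigma>"
      with elim have w: "Re (iter_ln j z) > exp K" by auto
      then have "exp K < norm (iter_ln j z)" using complex_Re_le_cmod[of "iter_ln j z"] by linarith
      then have "ln (exp K) < ln (norm (iter_ln j z))"
        by (subst ln_less_cancel_iff) (auto intro: less_trans[OF exp_gt_zero])
      moreover have "iter_ln j z \<noteq> 0" using w exp_gt_zero[of K] by auto
      ultimately show "Re (iter_ln (Suc j) z) > K" by simp
    qed
  qed
qed

lemma iter_ln_holomorphic:
  "\<forall>\<^sub>F \<sigma> in at_top. iter_ln j holomorphic_on {z::complex. Re z > \<sigma>}"
proof (induction j)
  case 0
  show ?case by (simp add: iter_ln_def)
next
  case (Suc j)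
  from Suc iter_ln_Re_gt[of 0 j] show ?case
  proof eventually_elim
    case (elim \<sigma>)
    have "(\<lambda>z. ln (iter_ln j z)) holomorphic_on {z::complex. Re z > \<sigma>}"
      using elim by (intro holomorphic_intros) (auto simp: complex_nonpos_Reals_iff not_le)
    then show ?case by simp
  qed
qed

lemma iter_ln_of_real:
  "\<forall>\<^sub>F x::real in at_top. iter_ln j (of_real x) = (of_real (iter_ln j x) :: complex)"
proof (induction j)
  case (Suc j)
  have "\<forall>\<^sub>F x::real in at_top. iter_ln j x > 0"
    using iter_ln_at_top[of j] unfolding filterlim_at_top_dense by blast
  with Suc show ?case by eventually_elim (simp add: Ln_of_real)
qed simp

lemma pow_log_holomorphic:
  "\<forall>\<^sub>F \<sigma> in at_top. pow_log \<alpha>s holomorphic_on {z::complex. Re z > \<sigma>}"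
proof -
  have "\<forall>\<^sub>F \<sigma> in at_top. \<forall>j\<in>{..<length \<alpha>s}. iter_ln j holomorphic_on {z::complex. Re z > \<sigma>} \<and>
      (\<forall>z::complex. Re z > \<sigma> \<longrightarrow> Re (iter_ln j z) > 0)"
    by (intro eventually_ball_finite ballI eventually_conj iter_ln_holomorphic iter_ln_Re_gt) auto
  then show ?thesis
  proof eventually_elim
    case (elim \<sigma>)
    have "(\<lambda>z. \<Prod>j<length \<alpha>s. iter_ln j z powr of_real (\<alpha>s ! j)) holomorphic_on {z::complex. Re z > \<sigma>}"
      using elim by (intro holomorphic_intros) (auto simp: complex_nonpos_Reals_iff not_le)
    then show ?case by (simp add: pow_log_def[abs_def])
  qed
qed

lemma pow_log_of_real:
  "\<forall>\<^sub>F x::real in at_top. pow_log \<alpha>s (of_real x) = (of_real (pow_log \<alpha>s x) :: complex)"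
proof -
  have "\<forall>\<^sub>F x::real in at_top. iter_ln j x > 0" for j
    using iter_ln_at_top[of j] unfolding filterlim_at_top_dense by blast
  then have "\<forall>\<^sub>F x in at_top. \<forall>j\<in>{..<length \<alpha>s}.
      iter_ln j (of_real x) = (of_real (iter_ln j x) :: complex) \<and> iter_ln j x > 0"
    by (intro eventually_ball_finite ballI eventually_conj iter_ln_of_real) auto
  then show ?thesis
  proof eventually_elim
    case (elim x)
    then show ?case unfolding pow_log_def of_real_prod
      by (intro prod.cong refl) (auto simp: powr_of_real less_imp_le)
  qed
qed

lemma lx_eval_holomorphic:
  "\<forall>\<^sub>F \<sigma> in at_top. lx_eval L holomorphic_on {z::complex. Re z > \<sigma>}"
proof (induction L)
  case (LogExp \<Phi> \<alpha>s)
  have "\<forall>\<^sub>F \<sigma> in at_top. \<forall>p\<in>set \<Phi>. lx_eval (snd p) holomorphic_on {z::complex. Re z > \<sigma>}"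
    using LogExp by (intro eventually_ball_finite ballI) (auto simp: snds.simps)
  then show ?case using pow_log_holomorphic[of \<alpha>s]
  proof eventually_elim
    case (elim \<sigma>)
    have "(\<lambda>z. \<Sum>(c, M)\<leftarrow>\<Phi>. of_real c * lx_eval M z) holomorphic_on {z::complex. Re z > \<sigma>}"
      using elim(1) by (induction \<Phi>) (auto intro!: holomorphic_intros simp: split_def)
    with elim(2) have "(\<lambda>z. exp (\<Sum>(c, M)\<leftarrow>\<Phi>. of_real c * lx_eval M z) * pow_log \<alpha>s z)
        holomorphic_on {z::complex. Re z > \<sigma>}"
      by (intro holomorphic_intros)
    then show ?case by (simp add: lx_eval.simps[abs_def])
  qed
qed

lemma lx_eval_of_real:
  "\<forall>\<^sub>F x::real in at_top. lx_eval L (of_real x) = (of_real (lx_eval L x) :: complex)"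
proof (induction L)
  case (LogExp \<Phi> \<alpha>s)
  have "\<forall>\<^sub>F x::real in at_top. \<forall>p\<in>set \<Phi>.
      lx_eval (snd p) (of_real x) = (of_real (lx_eval (snd p) x) :: complex)"
    using LogExp by (intro eventually_ball_finite ballI) (auto simp: snds.simps)
  then show ?case using pow_log_of_real[of \<alpha>s]
  proof eventually_elim
    case (elim x)
    have "(\<Sum>(c, M)\<leftarrow>\<Phi>. of_real c * lx_eval M (of_real x :: complex)) =
        of_real (\<Sum>(c, M)\<leftarrow>\<Phi>. c * lx_eval M x)"
      using elim(1) by (induction \<Phi>) auto
    with elim(2) show ?case by (simp add: exp_of_real)
  qed
qed

text \<open>Two reduced expressions of one real germ may differ as syntax. Their continuations are
  holomorphic on a common half-plane and agree on a real ray, so the identity theorem makes them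
  equal.\<close>

lemma lx_eval_continuation_unique:
  assumes "\<forall>\<^sub>F x::real in at_top. lx_eval L x = lx_eval L' x"
  shows "\<forall>\<^sub>F \<sigma> in at_top. \<forall>z::complex. Re z > \<sigma> \<longrightarrow> lx_eval L z = lx_eval L' z"
proof -
  have "\<forall>\<^sub>F x::real in at_top. lx_eval L (of_real x) = (lx_eval L' (of_real x) :: complex)"
    using assms lx_eval_of_real[of L] lx_eval_of_real[of L'] by eventually_elim simp
  then obtain x0 where x0: "lx_eval L (of_real x) = (lx_eval L' (of_real x) :: complex)"
    if "x \<ge> x0" for x :: real
    unfolding eventually_at_top_linorder by blast
  show ?thesis
    using lx_eval_holomorphic[of L] lx_eval_holomorphic[of L']
  proof eventually_elim
    case (elim \<sigma>)
    let ?S = "{z::complex. Re z > \<sigma>}"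
    \<comment> \<open>Beyond \<open>x0\<close> the two expressions agree on the real axis, and
      \<open>\<sigma> + 1\<close> places the accumulation point inside the open half-plane.\<close>
    define \<xi> where "\<xi> = max x0 (\<sigma> + 1)"
    show ?case
    proof (intro allI impI)
      fix z :: complex assume z: "Re z > \<sigma>"
      have "lx_eval L z - lx_eval L' z = 0"
      proof (rule analytic_continuation[of "\<lambda>z. lx_eval L z - lx_eval L' z" ?S "of_real ` {\<xi><..}" "of_real \<xi>"])
        show "(\<lambda>z. lx_eval L z - lx_eval L' z) holomorphic_on ?S"
          using elim by (intro holomorphic_intros)
        show "open ?S" by (rule open_halfspace_Re_gt)
        show "connected ?S" by (intro convex_connected convex_halfspace_Re_gt)
        show "of_real ` {\<xi><..} \<subseteq> ?S" "of_real \<xi> \<in> ?S" by (auto simp: \<xi>_def)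
        show "(of_real \<xi> :: complex) islimpt of_real ` {\<xi><..}"
          unfolding islimpt_approachable
        proof (intro allI impI)
          fix e :: real assume "e > 0"
          then show "\<exists>x'\<in>of_real ` {\<xi><..}. x' \<noteq> of_real \<xi> \<and> dist x' (of_real \<xi> :: complex) < e"
            by (intro bexI[of _ "of_real (\<xi> + e / 2)"] imageI) (auto simp: dist_of_real dist_real_def simp del: of_real_add)
        qed
        show "lx_eval L w - lx_eval L' w = 0" if "w \<in> of_real ` {\<xi><..}" for w :: complex
          using that x0 by (auto simp: \<xi>_def)
      qed (use z in auto)
      then show "lx_eval L z = lx_eval L' z" by simp
    qed
  qed
qed

section \<open>Fourier inversion\<close>

lemma gaussian_char:
  "(LINT s|lborel. cis (t * s) * of_real (std_normal_density s)) = of_real (exp (- t\<^sup>2 / 2))"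
proof -
  have "char std_normal_distribution t =
      (LINT s|lborel. std_normal_density s *\<^sub>R cis (t * s))"
    unfolding char_def by (subst integral_density) (auto simp: cis_conv_exp)
  then show ?thesis
    by (simp add: char_std_normal_distribution scaleR_conv_of_real mult.commute)
qed

text \<open>Gaussian regularization: after multiplication of \<open>F\<close> by
  \<open>g \<epsilon>\<close>, Fubini's theorem turns the left side into a Gaussian average of
  \<open>f\<close> around \<open>u\<close> at scale \<epsilon>. As \<epsilon> tends to 0, dominated
  convergence applies on both sides, by integrability of \<open>F\<close> on one and by boundedness
  and continuity of \<open>f\<close> on the other.\<close>

lemma fourier_inversion:
  fixes f :: "real \<Rightarrow> real" and F :: "real \<Rightarrow> complex"
  assumes f: "integrable lborel f" and cont: "continuous_on UNIV f" and bd: "\<And>v. \<bar>f v\<bar> \<le> B"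
    and F_def: "\<And>y. F y = (LINT v|lborel. of_real (f v) * cis (y * v))"
    and F: "integrable lborel F"
  shows "(LINT y|lborel. F y * cis (- (u * y))) = of_real (2 * pi * f u)"
proof -
  note [measurable] = borel_measurable_integrable[OF f] borel_measurable_integrable[OF F]
  have cis_meas[measurable]: "cis \<in> borel_measurable borel"
    by (intro borel_measurable_continuous_onI continuous_intros)
  define g where "g \<epsilon> y = exp (- (\<epsilon> * y)\<^sup>2 / 2)" for \<epsilon> y :: real
  have g_meas[measurable]: "g \<epsilon> \<in> borel_measurable borel" for \<epsilon> unfolding g_def by measurable
  have g_nonneg: "g \<epsilon> y \<ge> 0" for \<epsilon> y by (simp add: g_def)
  have g_std: "g \<epsilon> y = sqrt (2 * pi) * std_normal_density (\<epsilon> * y)" for \<epsilon> y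
    by (simp add: g_def std_normal_density_def)
  have g_int: "integrable lborel (g \<epsilon>)" if "\<epsilon> > 0" for \<epsilon>
  proof -
    have "integrable lborel (\<lambda>y. std_normal_density (0 + \<epsilon> * y))"
      using that by (intro lborel_integrable_real_affine) auto
    then show ?thesis by (simp add: g_std[abs_def])
  qed
  \<comment> \<open>The Gaussian is its own Fourier transform up to scaling; the substitution is
    \<open>y = s / \<epsilon>\<close>.\<close>
  have gauss: "(LINT y|lborel. of_real (g \<epsilon> y) * cis (t * y)) =
      of_real (2 * pi / \<epsilon> * std_normal_density (t / \<epsilon>))" if "\<epsilon> > 0" for \<epsilon> t
  proof -
    have "(LINT y|lborel. of_real (g \<epsilon> y) * cis (t * y)) =
      \<bar>1 / \<epsilon>\<bar> *\<^sub>R (LINT s|lborel. of_real (g \<epsilon> (0 + 1 / \<epsilon> * s)) * cis (t * (0 + 1 / \<epsilon> * s)))"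
      using that by (intro lborel_integral_real_affine) auto
    also have "\<dots> = (1 / \<epsilon>) *\<^sub>R (of_real (sqrt (2 * pi)) *
        (LINT s|lborel. cis (t / \<epsilon> * s) * of_real (std_normal_density s)))"
      using that by (subst integral_mult_right_zero[symmetric])
        (auto simp: g_std mult_ac intro!: arg_cong2[where f = scaleR] Bochner_Integration.integral_cong)
    also have "\<dots> = of_real (1 / \<epsilon> * (sqrt (2 * pi) * exp (- (t / \<epsilon>)\<^sup>2 / 2)))"
      by (simp only: gaussian_char) (simp add: scaleR_conv_of_real)
    also have "1 / \<epsilon> * (sqrt (2 * pi) * exp (- (t / \<epsilon>)\<^sup>2 / 2)) = 2 * pi / \<epsilon> * std_normal_density (t / \<epsilon>)"
    proof -
      have "2 * pi / \<epsilon> * std_normal_density (t / \<epsilon>) =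
          1 / \<epsilon> * ((2 * pi / sqrt (2 * pi)) * exp (- (t / \<epsilon>)\<^sup>2 / 2))"
        by (simp add: std_normal_density_def)
      then show ?thesis by (simp only: real_div_sqrt[of "2 * pi"] pi_ge_zero mult_nonneg_nonneg zero_le_numeral)
    qed
    finally show ?thesis .
  qed
  \<comment> \<open>The factor \<open>g \<epsilon>\<close> makes the double integral absolutely
    convergent. The order of integration is exchanged, the integral over \<open>y\<close> is
    evaluated by \<open>gauss\<close>, and \<open>v = u + \<epsilon> * w\<close> recentres the
    average.\<close>
  have key: "(LINT y|lborel. F y * cis (- (u * y)) * of_real (g \<epsilon> y)) =
      of_real (2 * pi * (LINT w|lborel. f (u + \<epsilon> * w) * std_normal_density w))"
    if \<epsilon>: "\<epsilon> > 0" for \<epsilon>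
  proof -
    define h :: "real \<Rightarrow> real \<Rightarrow> complex" where
      "h v y = of_real (f v) * of_real (g \<epsilon> y) * cis (y * v) * cis (- (u * y))" for v y
    have h_meas[measurable]: "case_prod h \<in> borel_measurable (lborel \<Otimes>\<^sub>M lborel)"
      unfolding h_def by measurable
    have norm_h: "norm (h v y) = \<bar>f v\<bar> * g \<epsilon> y" for v y
      by (simp add: h_def norm_mult g_def)
    have h_int: "integrable (lborel \<Otimes>\<^sub>M lborel) (case_prod h)"
    proof (rule lborel_pair.Fubini_integrable)
      show "integrable lborel (\<lambda>x. LINT y|lborel. norm (case_prod h (x, y)))"
        using f by (simp add: norm_h)
      show "AE x in lborel. integrable lborel (\<lambda>y. case_prod h (x, y))"
      proof (intro AE_I2)
        fix v
        show "integrable lborel (\<lambda>y. case_prod h (v, y))"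
        proof (rule Bochner_Integration.integrable_bound)
          show "integrable lborel (\<lambda>y. \<bar>f v\<bar> * g \<epsilon> y)"
            using g_int[OF \<epsilon>] by simp
          show "(\<lambda>y. case_prod h (v, y)) \<in> borel_measurable lborel"
            unfolding h_def prod.case by measurable
          show "AE y in lborel. norm (case_prod h (v, y)) \<le> norm (\<bar>f v\<bar> * g \<epsilon> y)"
            by (simp add: norm_h g_nonneg)
        qed
      qed
    qed simp
    have "(LINT y|lborel. F y * cis (- (u * y)) * of_real (g \<epsilon> y)) =
        (LINT y|lborel. LINT v|lborel. h v y)"
    proof (intro Bochner_Integration.integral_cong refl)
      fix y
      have "(LINT v|lborel. h v y) =
          (LINT v|lborel. (of_real (f v) * cis (y * v)) * (of_real (g \<epsilon> y) * cis (- (u * y))))"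
        by (simp add: h_def mult_ac)
      also have "\<dots> = F y * (of_real (g \<epsilon> y) * cis (- (u * y)))"
        by (simp only: F_def integral_mult_left_zero)
      finally show "F y * cis (- (u * y)) * of_real (g \<epsilon> y) = (LINT v|lborel. h v y)"
        by (simp add: mult_ac)
    qed
    also have "\<dots> = (LINT v|lborel. LINT y|lborel. h v y)"
      by (rule lborel_pair.Fubini_integral[OF h_int])
    also have "\<dots> = (LINT v|lborel. of_real (f v * (2 * pi / \<epsilon> * std_normal_density ((v - u) / \<epsilon>))))"
    proof (intro Bochner_Integration.integral_cong refl)
      fix v
      have "(LINT y|lborel. h v y) =
          (LINT y|lborel. of_real (f v) * (of_real (g \<epsilon> y) * cis ((v - u) * y)))"
        by (intro Bochner_Integration.integral_cong refl)
          (simp add: h_def cis_mult algebra_simps)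
      also have "\<dots> = of_real (f v) * (LINT y|lborel. of_real (g \<epsilon> y) * cis ((v - u) * y))"
        by (rule integral_mult_right_zero)
      finally show "(LINT y|lborel. h v y) =
          of_real (f v * (2 * pi / \<epsilon> * std_normal_density ((v - u) / \<epsilon>)))"
        by (simp add: gauss[OF \<epsilon>])
    qed
    also have "\<dots> = of_real (LINT v|lborel. f v * (2 * pi / \<epsilon> * std_normal_density ((v - u) / \<epsilon>)))"
      by (rule integral_complex_of_real)
    also have "(LINT v|lborel. f v * (2 * pi / \<epsilon> * std_normal_density ((v - u) / \<epsilon>))) =
        \<bar>\<epsilon>\<bar> *\<^sub>R (LINT w|lborel. f (u + \<epsilon> * w) * (2 * pi / \<epsilon> * std_normal_density ((u + \<epsilon> * w - u) / \<epsilon>)))"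
      using \<epsilon> by (intro lborel_integral_real_affine) auto
    also have "\<dots> = (LINT w|lborel. \<epsilon> * (f (u + \<epsilon> * w) * (2 * pi / \<epsilon> * std_normal_density ((u + \<epsilon> * w - u) / \<epsilon>))))"
      using \<epsilon> by simp
    also have "\<dots> = (LINT w|lborel. 2 * pi * (f (u + \<epsilon> * w) * std_normal_density w))"
      using \<epsilon> by (intro Bochner_Integration.integral_cong refl) (simp add: field_simps)
    also have "\<dots> = 2 * pi * (LINT w|lborel. f (u + \<epsilon> * w) * std_normal_density w)"
      by (rule integral_mult_right_zero)
    finally show ?thesis .
  qed
  \<comment> \<open>Dominated convergence is applied along a sequence of positive scales tending to
    0.\<close>
  define \<epsilon> where "\<epsilon> n = 1 / real (Suc n)" for n
  have \<epsilon>: "\<epsilon> n > 0" for n by (simp add: \<epsilon>_def)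
  have \<epsilon>0: "\<epsilon> \<longlonglongrightarrow> 0" unfolding \<epsilon>_def using LIMSEQ_inverse_real_of_nat by (simp add: inverse_eq_divide)
  have lim1: "(\<lambda>n. LINT y|lborel. F y * cis (- (u * y)) * of_real (g (\<epsilon> n) y))
      \<longlonglongrightarrow> (LINT y|lborel. F y * cis (- (u * y)))"
  proof (rule integral_dominated_convergence[where w = "\<lambda>y. norm (F y)"])
    show "AE y in lborel. (\<lambda>n. F y * cis (- (u * y)) * of_real (g (\<epsilon> n) y))
        \<longlonglongrightarrow> F y * cis (- (u * y))"
    proof (intro AE_I2)
      fix y
      have "(\<lambda>n. F y * cis (- (u * y)) * of_real (g (\<epsilon> n) y))
          \<longlonglongrightarrow> F y * cis (- (u * y)) * of_real (exp (- (0 * y)\<^sup>2 / 2))"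
        unfolding g_def by (intro tendsto_mult tendsto_const tendsto_of_real tendsto_exp
            tendsto_divide tendsto_minus tendsto_power \<epsilon>0) simp
      then show "(\<lambda>n. F y * cis (- (u * y)) * of_real (g (\<epsilon> n) y)) \<longlonglongrightarrow> F y * cis (- (u * y))"
        by simp
    qed
    show "AE y in lborel. norm (F y * cis (- (u * y)) * of_real (g (\<epsilon> n) y)) \<le> norm (F y)" for n
      by (intro AE_I2) (simp add: norm_mult g_def mult_left_le)
    show "integrable lborel (\<lambda>y. norm (F y))" using F by simp
  qed measurable
  have lim2: "(\<lambda>n. LINT w|lborel. f (u + \<epsilon> n * w) * std_normal_density w)
      \<longlonglongrightarrow> (LINT w|lborel. f u * std_normal_density w)"
  proof (rule integral_dominated_convergence[where w = "\<lambda>w. B * std_normal_density w"])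
    show "AE w in lborel. (\<lambda>n. f (u + \<epsilon> n * w) * std_normal_density w)
        \<longlonglongrightarrow> f u * std_normal_density w"
    proof (intro AE_I2 tendsto_mult tendsto_const)
      fix w
      have "(\<lambda>n. u + \<epsilon> n * w) \<longlonglongrightarrow> u + 0 * w" by (intro tendsto_intros \<epsilon>0)
      then have "(\<lambda>n. u + \<epsilon> n * w) \<longlonglongrightarrow> u" by simp
      moreover have "isCont f u" using cont by (simp add: continuous_on_eq_continuous_at)
      ultimately show "(\<lambda>n. f (u + \<epsilon> n * w)) \<longlonglongrightarrow> f u" by (rule isCont_tendsto_compose[rotated])
    qed
    show "AE w in lborel. norm (f (u + \<epsilon> n * w) * std_normal_density w) \<le> B * std_normal_density w" for n
      using bd by (intro AE_I2) (simp add: abs_mult mult_right_mono)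
    show "integrable lborel (\<lambda>w. B * std_normal_density w)" by simp
  qed measurable
  have "(\<lambda>n. complex_of_real (2 * pi * (LINT w|lborel. f (u + \<epsilon> n * w) * std_normal_density w)))
      \<longlonglongrightarrow> of_real (2 * pi * (LINT w|lborel. f u * std_normal_density w))"
    by (intro tendsto_of_real tendsto_mult tendsto_const lim2)
  then have "(\<lambda>n. LINT y|lborel. F y * cis (- (u * y)) * of_real (g (\<epsilon> n) y))
      \<longlonglongrightarrow> of_real (2 * pi * (LINT w|lborel. f u * std_normal_density w))"
    by (simp only: key[OF \<epsilon>])
  from LIMSEQ_unique[OF lim1 this] show ?thesis by simp
qed

section \<open>The Bromwich transform of the gamma monomial\<close>

lemma absolutely_integrable_lborel:
  fixes f :: "real \<Rightarrow> 'a::euclidean_space"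
  assumes "f \<in> borel_measurable borel"
  shows "f absolutely_integrable_on UNIV \<longleftrightarrow> integrable lborel f"
  using assms by (simp add: set_integrable_def integrable_completion)

lemma norm_Gamma_le:
  assumes "Re s > 0" shows "norm (Gamma s) \<le> Gamma (Re s)"
proof -
  have 1: "((\<lambda>t. of_real t powr (s - 1) / of_real (exp t)) has_integral Gamma s) {0..}"
    by (rule Gamma_integral_complex[OF assms])
  have 2: "((\<lambda>t. t powr (Re s - 1) / exp t) has_integral Gamma (Re s)) {0..}"
    by (rule Gamma_integral_real[OF assms])
  have "norm (integral {0..} (\<lambda>t. of_real t powr (s - 1) / of_real (exp t) :: complex))
      \<le> integral {0..} (\<lambda>t. t powr (Re s - 1) / exp t)"
  proof (rule integral_norm_bound_integral)
    fix t :: real assume "t \<in> {0..}"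
    then show "norm (of_real t powr (s - 1) / of_real (exp t) :: complex) \<le> t powr (Re s - 1) / exp t"
      by (simp add: norm_divide norm_powr_real_powr)
  qed (use 1 2 in blast)+
  then show ?thesis using 1 2 by (simp add: integral_unique)
qed

text \<open>Two applications of the functional equation give
  \<open>Gamma (s + 2) = (s + 1) * s * Gamma s\<close>, and the left side is bounded by the Gamma
  value at its real part. The resulting quadratic decay on vertical lines makes the Bromwich
  integral absolutely convergent.\<close>

lemma norm_Gamma_decay:
  assumes "Re s > 0"
  shows "norm (Gamma s) \<le> Gamma (Re s + 2) / norm s ^ 2"
proof -
  have s: "s \<notin> \<int>\<^sub>\<le>\<^sub>0" "s + 1 \<notin> \<int>\<^sub>\<le>\<^sub>0"
    using assms by (auto elim!: nonpos_Ints_cases simp: complex_eq_iff)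
  have "Gamma (s + 2) = (s + 1) * (s * Gamma s)"
    using Gamma_plus1[OF s(1)] Gamma_plus1[OF s(2)] by (simp add: add.assoc)
  then have "norm s * norm (s + 1) * norm (Gamma s) \<le> Gamma (Re s + 2)"
    using norm_Gamma_le[of "s + 2"] assms by (simp add: norm_mult mult_ac)
  moreover have "norm s \<le> norm (s + 1)"
    using assms unfolding cmod_def
    by (intro real_sqrt_le_mono) (simp add: power2_eq_square algebra_simps)
  then have "norm s ^ 2 * norm (Gamma s) \<le> norm s * norm (s + 1) * norm (Gamma s)"
    by (auto simp: power2_eq_square intro!: mult_mono)
  moreover have "norm s > 0" using assms by auto
  ultimately show ?thesis by (simp add: field_simps)
qed

text \<open>The tangent inequality for the exponential function at \<open>ln s\<close>, the point
  where the left side is maximal.\<close>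

lemma mult_minus_exp_le:
  assumes "s > (0::real)" shows "s * v - exp v \<le> s * ln s - s"
proof -
  have "1 + (v - ln s) \<le> exp (v - ln s)" by (rule exp_ge_add_one_self)
  then have "s * (1 + (v - ln s)) \<le> s * exp (v - ln s)" using assms by (intro mult_left_mono) auto
  also have "s * exp (v - ln s) = exp v" using assms by (simp add: exp_diff)
  finally show ?thesis by (simp add: algebra_simps)
qed

section \<open>The gamma monomial as a bilateral Laplace transform\<close>

locale factorial_series =
  fixes k :: nat and a :: real
  assumes k: "k \<ge> 1" and a: "a > 0"
begin

text \<open>The positive solution \<open>t\<close> of \<open>a * t ^ k = exp u\<close>.\<close>

definition \<tau> :: "real \<Rightarrow> real" where "\<tau> u = exp ((u - ln a) / k)"

text \<open>The density of the Euler weight \<open>exp (- t)\<close> in the variable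
  \<open>u\<close>, where \<open>dt\<close> becomes \<open>\<tau> u / k\<close> times
  \<open>du\<close>.\<close>

definition \<phi> :: "real \<Rightarrow> real" where "\<phi> u = \<tau> u * exp (- \<tau> u) / k"

lemma \<tau>_pos: "\<tau> u > 0" by (simp add: \<tau>_def)

lemma \<phi>_pos: "\<phi> u > 0" using \<tau>_pos k by (simp add: \<phi>_def)

lemma continuous_\<phi>: "continuous_on A \<phi>"
  unfolding \<phi>_def \<tau>_def using k by (intro continuous_intros) auto

lemma \<phi>_measurable [measurable]: "\<phi> \<in> borel_measurable borel"
  by (intro borel_measurable_continuous_onI continuous_\<phi>)

lemma \<tau>_deriv: "(\<tau> has_field_derivative \<tau> u / k) (at u within A)"
  unfolding \<tau>_def using k by (auto intro!: derivative_eq_intros)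

lemma \<tau>_inj: "inj \<tau>"
  using k by (auto simp: \<tau>_def inj_on_def)

lemma \<tau>_range: "range \<tau> = {0<..}"
proof -
  have "t = \<tau> (ln a + k * ln t)" if "t > 0" for t using that k by (simp add: \<tau>_def)
  then show ?thesis using \<tau>_pos by (auto intro!: image_eqI)
qed

lemma \<tau>_pow: "a * \<tau> u ^ k = exp u"
  using k a by (simp add: \<tau>_def exp_of_nat_mult[symmetric] exp_diff)

text \<open>The substitution \<open>u = ln (a t\<^sup>k)\<close>.\<close>

lemma substitution:
  fixes h :: "real \<Rightarrow> 'a::euclidean_space"
  assumes [measurable]: "(\<lambda>u. h (\<tau> u)) \<in> borel_measurable borel"
  shows "h absolutely_integrable_on {0<..} \<and> integral {0<..} h = b \<longleftrightarrow>
    has_bochner_integral lborel (\<lambda>u. (\<tau> u / k) *\<^sub>R h (\<tau> u)) b"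
proof -
  let ?g = "\<lambda>u. (\<tau> u / k) *\<^sub>R h (\<tau> u)"
  have [measurable]: "\<tau> \<in> borel_measurable borel" unfolding \<tau>_def by measurable
  have "(\<lambda>u. \<bar>\<tau> u / k\<bar> *\<^sub>R h (\<tau> u)) = ?g"
    by (simp add: abs_of_pos[OF \<tau>_pos])
  with has_absolute_integral_change_of_variables_real[OF _ \<tau>_deriv \<tau>_inj, of h b]
  have "h absolutely_integrable_on {0<..} \<and> integral {0<..} h = b \<longleftrightarrow>
      ?g absolutely_integrable_on UNIV \<and> integral UNIV ?g = b"
    by (simp only: \<tau>_range sets.top) simp
  also have "\<dots> \<longleftrightarrow> integrable lborel ?g \<and> integral UNIV ?g = b"
    by (subst absolutely_integrable_lborel) auto
  also have "\<dots> \<longleftrightarrow> has_bochner_integral lborel ?g b"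
    using integral_lborel[of ?g] by (auto simp: has_bochner_integral_iff)
  finally show ?thesis .
qed

text \<open>Euler's integral for \<open>Gamma (k * z + 1)\<close> in the variable \<open>u\<close>:
  the power of \<open>t\<close> with exponent \<open>k * z\<close> becomes
  \<open>exp ((u - ln a) * z)\<close>. The boundary \<open>Re z = 0\<close> is included because the
  value at \<open>N = 0\<close> is needed for the sum.\<close>

lemma laplace:
  assumes "Re z \<ge> 0"
  shows "has_bochner_integral lborel (\<lambda>u. of_real (\<phi> u) * exp (of_real u * z))
     (exp (of_real (ln a) * z) * Gamma (of_nat k * z + 1))"
proof -
  let ?s = "of_nat k * z + 1"
  have s: "Re ?s > 0" using assms by (simp add: add_nonneg_pos)
  have "has_bochner_integral lborel (\<lambda>u. (\<tau> u / k) *\<^sub>R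
      (of_real (\<tau> u) powr (?s - 1) / of_real (exp (\<tau> u)))) (Gamma ?s)"
  proof (rule substitution[THEN iffD1, OF _ conjI])
    show "(\<lambda>t. of_real t powr (?s - 1) / of_real (exp t)) absolutely_integrable_on {0<..}"
      by (rule absolutely_integrable_Gamma_integral'[OF s])
    show "integral {0<..} (\<lambda>t. of_real t powr (?s - 1) / of_real (exp t)) = Gamma ?s"
      by (rule integral_unique[OF Gamma_integral_complex'[OF s]])
    show "(\<lambda>u. of_real (\<tau> u) powr (?s - 1) / of_real (exp (\<tau> u))) \<in> borel_measurable borel"
      unfolding \<tau>_def powr_def by measurable
  qed
  from has_bochner_integral_mult_right[OF this, of "exp (of_real (ln a) * z)"]
  have "has_bochner_integral lborel (\<lambda>u. exp (of_real (ln a) * z) * ((\<tau> u / k) *\<^sub>R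
      (of_real (\<tau> u) powr (?s - 1) / of_real (exp (\<tau> u))))) (exp (of_real (ln a) * z) * Gamma ?s)"
    by simp
  moreover have "exp (of_real (ln a) * z) * ((\<tau> u / k) *\<^sub>R
      (of_real (\<tau> u) powr (?s - 1) / of_real (exp (\<tau> u)))) = of_real (\<phi> u) * exp (of_real u * z)" for u
  proof -
    have "Ln (of_real (\<tau> u)) = of_real ((u - ln a) / k)"
      using \<tau>_pos[of u] by (subst Ln_of_real) (auto simp: \<tau>_def)
    then have "of_real (\<tau> u) powr (?s - 1) = exp (of_real (u - ln a) * z)"
      using \<tau>_pos[of u] k by (simp add: powr_def mult.commute)
    moreover have "exp (of_real u * z) = exp (of_real (ln a) * z) * exp (of_real (u - ln a) * z)"
      by (simp add: exp_add[symmetric] algebra_simps)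
    ultimately show ?thesis
      by (simp add: \<phi>_def scaleR_conv_of_real exp_minus field_simps)
  qed
  ultimately show ?thesis by simp
qed

lemma laplace_real:
  fixes \<sigma> :: real
  assumes "\<sigma> \<ge> 0"
  shows "has_bochner_integral lborel (\<lambda>u. \<phi> u * exp (\<sigma> * u)) (exp (ln a * \<sigma>) * Gamma (k * \<sigma> + 1))"
proof -
  have "has_bochner_integral lborel (\<lambda>u. complex_of_real (\<phi> u) * exp (of_real u * of_real \<sigma>))
     (exp (of_real (ln a) * of_real \<sigma>) * Gamma (of_nat k * of_real \<sigma> + 1))"
    using assms by (intro laplace) simp
  also have "(\<lambda>u. complex_of_real (\<phi> u) * exp (of_real u * of_real \<sigma>)) =
      (\<lambda>u. of_real (\<phi> u * exp (\<sigma> * u)))"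
    by (simp add: exp_of_real[symmetric] mult.commute)
  also have "exp (of_real (ln a) * of_real \<sigma>) * Gamma (of_nat k * of_real \<sigma> + 1) =
      complex_of_real (exp (ln a * \<sigma>) * Gamma (k * \<sigma> + 1))"
    by (simp add: exp_of_real[symmetric] Gamma_complex_of_real[symmetric])
  finally show ?thesis
    by (auto dest: has_bochner_integral_Re simp del: of_real_mult)
qed

text \<open>The term \<open>LogExp [] []\<close> is the constant germ 1, and the power of
  \<open>a\<close> enters through the exponential rate \<open>ln a\<close>.\<close>

definition G :: gmon where "G = GammaType (ln a) (LogExp [] []) k"

lemma gm_eval_G:
  "gm_eval G z = exp (of_real (ln a) * z) * Gamma (of_nat k * z + 1)"
  by (simp add: G_def gamma_germ_def pow_log_def)

text \<open>In the variable \<open>v = ln (\<tau> u)\<close> the function is a constant times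
  \<open>exp (s * v - exp v)\<close> with \<open>s = k * \<sigma> + 1\<close>, which is bounded
  above. Fourier inversion asks for such a bound.\<close>

lemma weighted_\<phi>_bounded:
  assumes "\<sigma> > 0"
  shows "\<exists>B. \<forall>u. \<bar>\<phi> u * exp (\<sigma> * u)\<bar> \<le> B"
proof (intro exI allI)
  fix u
  define v where "v = (u - ln a) / k"
  let ?s = "k * \<sigma> + 1"
  have u: "u = ln a + k * v" using k by (simp add: v_def)
  have s: "?s > 0" using assms by (simp add: add_nonneg_pos)
  have "\<bar>\<phi> u * exp (\<sigma> * u)\<bar> = \<phi> u * exp (\<sigma> * u)" using \<phi>_pos[of u] by simp
  also have "\<dots> = exp (\<sigma> * ln a) / k * exp (?s * v - exp v)"
    by (simp add: \<phi>_def \<tau>_def v_def[symmetric]) (simp add: u exp_add[symmetric] algebra_simps)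
  also have "\<dots> \<le> exp (\<sigma> * ln a) / k * exp (?s * ln ?s - ?s)"
    using mult_minus_exp_le[OF s] by (intro mult_left_mono) auto
  finally show "\<bar>\<phi> u * exp (\<sigma> * u)\<bar> \<le> exp (\<sigma> * ln a) / k * exp (?s * ln ?s - ?s)" .
qed

lemma gm_eval_G_line_continuous:
  assumes "\<sigma> > 0" shows "continuous_on UNIV (\<lambda>y. gm_eval G (Complex \<sigma> y))"
proof -
  have ne: "of_nat k * (of_real \<sigma> + \<i> * of_real y) + 1 \<notin> (\<int>\<^sub>\<le>\<^sub>0 :: complex set)" for y
  proof
    assume "of_nat k * (of_real \<sigma> + \<i> * of_real y) + 1 \<in> \<int>\<^sub>\<le>\<^sub>0"
    then obtain n where n: "of_nat k * (of_real \<sigma> + \<i> * of_real y) + 1 = (of_int n :: complex)" "n \<le> 0"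
      by (auto elim!: nonpos_Ints_cases)
    have "Re (of_nat k * (of_real \<sigma> + \<i> * of_real y) + 1) \<le> 0"
      unfolding n(1) using n(2) by simp
    moreover have "k * \<sigma> + 1 > 0" using assms by (simp add: add_nonneg_pos)
    ultimately show False by simp
  qed
  have "continuous_on UNIV (\<lambda>y. Gamma (of_nat k * (of_real \<sigma> + \<i> * of_real y) + 1 :: complex))"
    by (rule continuous_on_compose2[OF continuous_on_Gamma[of "- \<int>\<^sub>\<le>\<^sub>0"]])
      (use ne in \<open>auto intro!: continuous_intros\<close>)
  moreover have "continuous_on UNIV (\<lambda>y. exp (c * (of_real \<sigma> + \<i> * of_real y) :: complex))" for c
    by (intro continuous_intros)
  ultimately show ?thesis
    unfolding gm_eval_G Complex_eq by (intro continuous_on_mult)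
qed

text \<open>Since \<open>k \<ge> 1\<close> and \<open>\<sigma> > 0\<close>, the squared norm of
  \<open>k * z + 1\<close> on the line is at least \<open>1 + y ^ 2\<close>. The quadratic decay of
  Gamma then provides an integrable majorant.\<close>

lemma gm_eval_G_line_integrable:
  assumes "\<sigma> > 0" shows "integrable lborel (\<lambda>y. gm_eval G (Complex \<sigma> y))"
proof (rule Bochner_Integration.integrable_bound)
  define K where "K = exp (ln a * \<sigma>) * Gamma (k * \<sigma> + 1 + 2)"
  have kpos: "k * \<sigma> + 1 > 0" using assms by (simp add: add_nonneg_pos)
  have "integrable lborel (\<lambda>y::real. inverse (1 + y^2))"
    using integrable_inverse_1_plus_square by (simp add: set_integrable_def)
  then show "integrable lborel (\<lambda>y::real. K * inverse (1 + y^2))" by simp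
  show "(\<lambda>y. gm_eval G (Complex \<sigma> y)) \<in> borel_measurable lborel"
    using borel_measurable_continuous_onI[OF gm_eval_G_line_continuous[OF assms]] by simp
  show "AE y in lborel. norm (gm_eval G (Complex \<sigma> y)) \<le> norm (K * inverse (1 + y\<^sup>2))"
  proof (intro AE_I2)
    fix y
    let ?s = "of_nat k * Complex \<sigma> y + 1"
    have Re: "Re ?s = k * \<sigma> + 1" and Im: "Im ?s = k * y" by auto
    have "1 * 1 \<le> real k ^ 2 \<and> 1 \<le> (k * \<sigma> + 1)^2" using k assms by auto
    then have "1 + y^2 \<le> (k * \<sigma> + 1)^2 + (real k)^2 * y^2"
      by (intro add_mono) (auto simp: mult_le_cancel_right1)
    also have "\<dots> = norm ?s ^ 2" by (simp only: cmod_power2 Re Im power_mult_distrib)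
    finally have n: "1 + y^2 \<le> norm ?s ^ 2" .
    have y: "1 + y\<^sup>2 > 0" by (simp add: add_pos_nonneg)
    have "norm (Gamma ?s) \<le> Gamma (Re ?s + 2) / norm ?s ^ 2"
      using kpos Re by (intro norm_Gamma_decay) simp
    also have "\<dots> \<le> Gamma (k * \<sigma> + 1 + 2) / (1 + y^2)"
      unfolding Re using n kpos y
      by (intro divide_left_mono mult_pos_pos less_imp_le[OF Gamma_real_pos]) linarith+
    finally have "exp (ln a * \<sigma>) * norm (Gamma ?s) \<le> exp (ln a * \<sigma>) * (Gamma (k * \<sigma> + 1 + 2) / (1 + y^2))"
      by (intro mult_left_mono) auto
    then have "norm (gm_eval G (Complex \<sigma> y)) \<le> K * inverse (1 + y\<^sup>2)"
      by (simp add: gm_eval_G norm_mult K_def divide_inverse mult.assoc)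
    then show "norm (gm_eval G (Complex \<sigma> y)) \<le> norm (K * inverse (1 + y\<^sup>2))"
      by simp
  qed
qed

lemma bromwich_integrand_G:
  "bromwich_integrand [(1, G)] \<sigma> u y =
     of_real (exp (- u * \<sigma>)) * (gm_eval G (Complex \<sigma> y) * cis (- (u * y)))"
proof -
  have "exp (- (of_real u * Complex \<sigma> y)) = of_real (exp (- u * \<sigma>)) * cis (- (u * y))"
    by (simp add: Complex_eq cis_conv_exp exp_of_real[symmetric] exp_add[symmetric] algebra_simps)
  then show ?thesis by (simp add: bromwich_integrand_def MF_cont_def mult_ac)
qed

text \<open>On the line, \<open>G\<close> is the Fourier transform of
  \<open>\<phi> u * exp (\<sigma> * u)\<close>. Inversion recovers this function, and the factor
  \<open>exp (- u * \<sigma>)\<close> of the integrand removes the weight. The value is therefore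
  the same on all lines, for every \<open>u\<close> and not only almost everywhere.\<close>

lemma bromwich_line_G:
  assumes "\<sigma> > 0"
  shows "integrable lborel (bromwich_integrand [(1, G)] \<sigma> u)" "bromwich_line [(1, G)] \<sigma> u = of_real (\<phi> u)"
proof -
  let ?F = "\<lambda>y. gm_eval G (Complex \<sigma> y)"
  have F: "integrable lborel ?F" by (rule gm_eval_G_line_integrable[OF assms])
  have cis_meas[measurable]: "cis \<in> borel_measurable borel"
    by (intro borel_measurable_continuous_onI continuous_intros)
  have "integrable lborel (\<lambda>y. ?F y * cis (- (u * y)))"
    using borel_measurable_integrable[OF F]
    by (intro Bochner_Integration.integrable_bound[OF F]) (auto simp: norm_mult)
  then show "integrable lborel (bromwich_integrand [(1, G)] \<sigma> u)"
    unfolding bromwich_integrand_G[abs_def] by simp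
  obtain B where B: "\<And>u. \<bar>\<phi> u * exp (\<sigma> * u)\<bar> \<le> B" using weighted_\<phi>_bounded[OF assms] by blast
  have "(LINT y|lborel. ?F y * cis (- (u * y))) = of_real (2 * pi * (\<phi> u * exp (\<sigma> * u)))"
  proof (rule fourier_inversion[OF _ _ B _ F])
    show "integrable lborel (\<lambda>u. \<phi> u * exp (\<sigma> * u))"
      using laplace_real[of \<sigma>] assms by (simp add: has_bochner_integral_iff)
    show "continuous_on UNIV (\<lambda>u. \<phi> u * exp (\<sigma> * u))"
      by (intro continuous_intros continuous_\<phi>)
    fix y
    have "?F y = (LINT u|lborel. of_real (\<phi> u) * exp (of_real u * Complex \<sigma> y))"
      using laplace[of "Complex \<sigma> y"] assms by (simp add: has_bochner_integral_iff gm_eval_G)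
    also have "\<dots> = (LINT v|lborel. of_real (\<phi> v * exp (\<sigma> * v)) * cis (y * v))"
      by (intro Bochner_Integration.integral_cong refl)
        (simp add: Complex_eq cis_conv_exp exp_of_real[symmetric] exp_add[symmetric] algebra_simps)
    finally show "?F y = (LINT v|lborel. of_real (\<phi> v * exp (\<sigma> * v)) * cis (y * v))" .
  qed
  then show "bromwich_line [(1, G)] \<sigma> u = of_real (\<phi> u)"
    by (simp add: bromwich_line_def bromwich_integrand_G exp_minus field_simps del: of_real_exp)
qed

end

section \<open>Selectors and the finite part\<close>

lemma normalized_tail_diff:
  assumes "recurrence_presentation s n0 a b \<mu>" "recurrence_solution n0 a b \<mu> I"
  shows "normalized_tail n0 a b I N - normalized_tail n0 a b I (Suc N) = s N"
proof -
  have ne: "a n \<noteq> 0" "b n \<noteq> 0" if "n \<ge> n0" for n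
    using assms(1) that by (auto simp: recurrence_presentation_def)
  \<comment> \<open>Up to the factor \<open>a (n0 + N)\<close>, the normalizing quotient is the
    signed product of the presentation. With the tail written this way, the recurrence is exactly
    its difference.\<close>
  have prod: "a n0 / (\<Prod>i=n0..<n0 + N. - a i / b i) =
      a (n0 + N) * ((-1) ^ N * (\<Prod>j<N. b (n0 + j) / a (n0 + j + 1)))" for N
  proof (induction N)
    case (Suc N)
    have "a n0 / (\<Prod>i=n0..<n0 + Suc N. - a i / b i) =
        a n0 / (\<Prod>i=n0..<n0 + N. - a i / b i) * (- b (n0 + N) / a (n0 + N))"
      using ne[of "n0 + N"] by (simp add: field_simps)
    also have "\<dots> = a (n0 + Suc N) * ((-1) ^ Suc N * (\<Prod>j<Suc N. b (n0 + j) / a (n0 + j + 1)))"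
      unfolding Suc using ne[of "n0 + N"] ne[of "n0 + Suc N"] by (simp add: field_simps)
    finally show ?case .
  qed simp
  let ?n = "n0 + N" and ?Q = "(-1) ^ N * (\<Prod>j<N. b (n0 + j) / a (n0 + j + 1))"
  have tail: "normalized_tail n0 a b I M =
      a (n0 + M) * ((-1) ^ M * (\<Prod>j<M. b (n0 + j) / a (n0 + j + 1))) * I (n0 + M)" for M
    unfolding prod[of M, symmetric] by (simp add: normalized_tail_def)
  have "normalized_tail n0 a b I N - normalized_tail n0 a b I (Suc N) =
      ?Q * (a ?n * I ?n + b ?n * I (?n + 1))"
    unfolding tail using ne[of "n0 + Suc N"] by (simp add: algebra_simps)
  also have "\<dots> = ?Q * \<mu> ?n" using assms(2) by (simp add: recurrence_solution_def)
  also have "\<dots> = s N" using assms(1) by (simp add: recurrence_presentation_def mult_ac)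
  finally show ?thesis .
qed

lemma MF_germ_lincomb: "MF_germ l x = lincomb gm_eval l x"
  by (induction l) (auto simp: MF_germ_def scaleR_conv_of_real mult.commute)

lemma MM_germ_phase_split:
  "MM_germ c x = MF_germ (phase_plus c) x + exp (\<i> * of_real (pi * x)) * MF_germ (phase_minus c) x"
  by (induction c)
    (auto simp: MM_germ_def MF_germ_def phase_plus_def phase_minus_def algebra_simps)

text \<open>A pair of coefficients is nonzero as a pair only. Filtering out the zero entries of one
  phase restores nonzero coefficients, and a sublist of a sorted list is sorted.\<close>

lemma phase_normal_form:
  assumes "c \<in> MM" shows "gm.normal_form (phase_plus c)" "gm.normal_form (phase_minus c)"
proof -
  have dom: "dominates m n \<longleftrightarrow> gm.prec n m" for m n by (simp add: dominates_def gm.prec_def)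
  from assms have "sorted_wrt (\<lambda>p q. gm.prec (snd q) (snd p)) c"
    and c: "\<forall>(AB, M) \<in> set c. AB \<noteq> (0, 0) \<and> M \<in> growth_monomials"
    by (auto simp: MM_def sorted_wrt_map dom)
  then have "sorted_wrt (\<lambda>m n. gm.prec n m) (map snd (phase_plus c))"
    "sorted_wrt (\<lambda>m n. gm.prec n m) (map snd (phase_minus c))"
    unfolding phase_plus_def phase_minus_def sorted_wrt_map
    by (intro sorted_wrt_filter; simp add: sorted_wrt_map split_def)+
  then show "gm.normal_form (phase_plus c)" "gm.normal_form (phase_minus c)"
    using c by (auto simp: gm.normal_form_def phase_plus_def phase_minus_def)
qed

text \<open>The predicate \<open>Q\<close> stands for the parity of the integers on which the
  identity is known.\<close>

lemma frequently_real_of_nat: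
  assumes "\<forall>\<^sub>F N in sequentially. Q N \<longrightarrow> P (real N)" "\<And>n. \<exists>N\<ge>n. Q N"
  shows "\<exists>\<^sub>F x in at_top. P (x::real)"
proof (rule ccontr)
  assume "\<not> ?thesis"
  then obtain x where x: "\<And>y. y \<ge> x \<Longrightarrow> \<not> P y"
    by (auto simp: not_frequently eventually_at_top_linorder)
  from assms(1) obtain n where n: "\<And>N. N \<ge> n \<Longrightarrow> Q N \<Longrightarrow> P (real N)"
    by (auto simp: eventually_sequentially)
  obtain N where N: "N \<ge> max n (nat \<lceil>x\<rceil>)" "Q N" using assms(2) by blast
  then have "real N \<ge> x" by linarith
  with x n N show False by auto
qed

lemma exp_pi_nat: "exp (\<i> * of_real (pi * real N)) = (-1) ^ N"
proof -
  have "exp (\<i> * of_real (pi * real N)) = exp (of_nat N * (\<i> * of_real pi))"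
    by (simp add: mult_ac)
  also have "\<dots> = exp (\<i> * of_real pi) ^ N" by (rule exp_of_nat_mult)
  also have "exp (\<i> * of_real pi) = -1" using exp_pi_i by (simp add: mult.commute)
  finally show ?thesis .
qed

lemma bromwich_eqI:
  assumes "\<forall>\<^sub>F \<sigma> in at_top. bromwich_line l \<sigma> u = v"
  shows "bromwich l u = v"
  unfolding bromwich_def
proof (rule the_equality)
  fix w assume "\<forall>\<^sub>F \<sigma> in at_top. bromwich_line l \<sigma> u = w"
  with assms have "\<forall>\<^sub>F \<sigma>::real in at_top. w = v" by eventually_elim simp
  then show "w = v" by simp
qed (rule assms)

lemma bromwich_line_Nil: "bromwich_line [] \<sigma> u = 0"
  and bromwich_integrand_Nil: "bromwich_integrand [] \<sigma> u y = 0"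
  by (simp_all add: bromwich_line_def bromwich_integrand_def MF_cont_def)

text \<open>The difference germ of the series has no non-oscillating phase, so the principal-value
  selector only has to be evaluated at the zero germ.\<close>

lemma sel_plus_Nil: "sel_plus_exists [] N" "sel_plus [] N = 0"
proof -
  have "bromwich [] u = 0" for u by (rule bromwich_eqI) (simp add: bromwich_line_Nil)
  then have 0: "sel_plus_integrand [] N u = 0" for u by (simp add: sel_plus_integrand_def)
  then have "sel_plus_cut [] N = (\<lambda>_. 0)"
    by (simp add: sel_plus_cut_def set_lebesgue_integral_def fun_eq_iff)
  then show "sel_plus_exists [] N" "sel_plus [] N = 0"
    using 0 by (auto simp: sel_plus_exists_def sel_plus_def set_integrable_def intro!: tendsto_Lim)
qed

lemma bromwich_admissible_Nil: "bromwich_admissible []"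
  by (auto simp: bromwich_admissible_def MF_def bromwich_line_Nil bromwich_integrand_Nil[abs_def] MF_germ_def)

lemma LE_subexp_one: "LogExp [] [] \<in> LE_subexp"
proof -
  have "LogExp [] [] \<in> LE_upto 0" by simp
  then have "LogExp [] [] \<in> LE" unfolding LE_def by blast
  then show ?thesis by (simp add: LE_subexp_def pow_log_def)
qed

section \<open>Uniqueness of the phases of the difference germ\<close>

context factorial_series
begin

lemma G_growth: "G \<in> growth_monomials"
  using LE_subexp_one k by (simp add: G_def growth_monomials_def)

lemma gm_eval_G_nat: "gm_eval G (real N) = a ^ N * fact (k * N)"
proof -
  have "exp (ln a * real N) = a ^ N" using a by (simp add: exp_of_nat2_mult)
  moreover have "Gamma (real k * real N + 1) = fact (k * N)"
    using Gamma_fact[of "k * N", where 'a = real] by (simp add: add.commute)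
  ultimately show ?thesis by (simp add: gm_eval_G)
qed

text \<open>On the even integers a germ with these values is \<open>c\<^sup>+ + c\<^sup>-\<close>, on the odd ones \<open>c\<^sup>+ - c\<^sup>-\<close>;
  they agree with \<open>G\<close> and \<open>-G\<close> there, that is infinitely often, hence as germs.\<close>

lemma phases_of_selected:
  assumes "c \<in> MM"
    and germ: "\<forall>\<^sub>F N in sequentially. MM_germ c (real N) = (-1) ^ N * of_real (gm_eval G (real N))"
  obtains H where "phase_plus c = []" "phase_minus c = [(1, GammaType (ln a) H k)]"
    "\<forall>\<^sub>F x::real in at_top. lx_eval H x = 1"
proof -
  let ?P = "phase_plus c" and ?Q = "phase_minus c"
  let ?p = "lincomb gm_eval ?P" and ?q = "lincomb gm_eval ?Q"
  note nf = phase_normal_form[OF assms(1)]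
  have growth: "snd ` set ?P \<subseteq> growth_monomials" "snd ` set ?Q \<subseteq> growth_monomials"
    using nf by (auto simp: gm.normal_form_def)
  have vals: "\<forall>\<^sub>F N in sequentially. ?p (real N) + (-1) ^ N * ?q (real N) =
      (-1) ^ N * of_real (gm_eval G (real N))"
    using germ unfolding MM_germ_phase_split exp_pi_nat MF_germ_lincomb .
  \<comment> \<open>The scalar \<open>s\<close> is the constant value of \<open>(-1) ^ N\<close> on
    the integers satisfying \<open>Q\<close>. There the equation for \<open>c\<close> becomes a
    single relation without oscillation, to which the zero principle applies.\<close>
  have zero: "\<forall>\<^sub>F x in at_top. ?p x + s *\<^sub>R ?q x = of_real (s * gm_eval G x)"
    if s: "s = 1 \<and> Q = even \<or> s = -1 \<and> Q = odd" for s :: real and Q :: "nat \<Rightarrow> bool"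
  proof -
    let ?L = "?P @ map (\<lambda>(C, M). (of_real s * C, M)) ?Q @ [(- of_real s, G)]"
    have scale: "lincomb gm_eval (map (\<lambda>(C, M). (of_real s * C, M)) l) x = of_real s * lincomb gm_eval l x"
      for l :: "(complex \<times> gmon) list" and x
      by (induction l) (auto simp: algebra_simps)
    have L: "lincomb gm_eval ?L x = ?p x + s *\<^sub>R ?q x - of_real (s * gm_eval G x)" for x
      by (simp add: scale scaleR_conv_of_real)
    have "\<forall>\<^sub>F x in at_top. lincomb gm_eval ?L x = 0"
    proof (rule gm.lincomb_frequently_0)
      show "snd ` set ?L \<subseteq> growth_monomials" using growth G_growth by force
      show "\<exists>\<^sub>F x in at_top. lincomb gm_eval ?L x = 0"
      proof (rule frequently_real_of_nat)
        show "\<forall>\<^sub>F N in sequentially. Q N \<longrightarrow> lincomb gm_eval ?L (real N) = 0"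
          using vals
        proof eventually_elim
          case (elim N)
          have "s = (-1) ^ N" if "Q N" using s that by auto
          with elim show ?case
            unfolding L by (auto simp: scaleR_conv_of_real)
        qed
        show "\<exists>N\<ge>n. Q N" for n
          using s by (intro exI[of _ "if Q n then n else Suc n"]) auto
      qed
    qed
    then show ?thesis unfolding L by eventually_elim simp
  qed
  have ev: "\<forall>\<^sub>F x in at_top. ?p x = 0 \<and> ?q x = of_real (gm_eval G x)"
    using zero[of 1 even, OF disjI1[OF conjI[OF refl refl]]]
      zero[of "-1" odd, OF disjI2[OF conjI[OF refl refl]]]
  proof eventually_elim
    case (elim x)
    have "2 * ?p x = (?p x + 1 *\<^sub>R ?q x) + (?p x + (-1) *\<^sub>R ?q x)" by simp
    also have "\<dots> = 0" unfolding elim by simp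
    finally show ?case using elim(1) by simp
  qed
  have P: "?P = []"
    using ev by (intro gm.normal_form_frequently_0[OF nf(1)] eventually_frequently)
      (auto elim: eventually_mono)
  have Gpos: "\<forall>\<^sub>F x::real in at_top. gm_eval G x > 0" by (rule gm.pos[OF G_growth])
  obtain C M r where Q: "?Q = (C, M) # r"
  proof (cases ?Q)
    case Nil
    have "\<forall>\<^sub>F x::real in at_top. False"
      using ev Gpos by eventually_elim (simp add: Nil)
    then show ?thesis by simp
  qed auto
  have nfQ: "C \<noteq> 0" "M \<in> growth_monomials" "gm.normal_form r"
    using nf(2) by (auto simp: Q gm.normal_form_Cons)
  \<comment> \<open>The leading monomial \<open>M\<close> of the minus phase satisfies
    \<open>G / M\<close> \<longlongrightarrow> \<open>C\<close> with \<open>C\<close> nonzero. Of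
    the three cases of comparability only equality survives, so \<open>C = 1\<close> and the
    remaining terms \<open>r\<close> sum to zero.\<close>
  have lim: "((\<lambda>x. complex_of_real (gm_eval G x / gm_eval M x)) \<longlongrightarrow> C) at_top"
  proof (rule Lim_transform_eventually)
    show "((\<lambda>x. ?q x /\<^sub>R gm_eval M x) \<longlongrightarrow> C) at_top"
      using gm.leading_term[of C M r] nf(2) unfolding Q .
    show "\<forall>\<^sub>F x in at_top. ?q x /\<^sub>R gm_eval M x = complex_of_real (gm_eval G x / gm_eval M x)"
      using ev by eventually_elim (simp add: scaleR_conv_of_real divide_inverse mult.commute)
  qed
  have GM: "\<forall>\<^sub>F x::real in at_top. gm_eval G x = gm_eval M x"
    using gm.comparable[OF G_growth nfQ(2)]
  proof (elim disjE)
    assume "((\<lambda>x::real. gm_eval G x / gm_eval M x) \<longlongrightarrow> 0) at_top"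
    from tendsto_of_real[OF this, where 'a = complex] have "((\<lambda>x. complex_of_real (gm_eval G x / gm_eval M x)) \<longlongrightarrow> 0) at_top"
      by simp
    from tendsto_unique[OF _ lim this] nfQ(1) show ?thesis by simp
  next
    assume "((\<lambda>x::real. gm_eval M x / gm_eval G x) \<longlongrightarrow> 0) at_top"
    from tendsto_of_real[OF this, where 'a = complex] have "((\<lambda>x. complex_of_real (gm_eval M x / gm_eval G x)) \<longlongrightarrow> 0) at_top"
      by simp
    from tendsto_mult[OF lim this]
    have "((\<lambda>x. complex_of_real (gm_eval G x / gm_eval M x) * complex_of_real (gm_eval M x / gm_eval G x))
        \<longlongrightarrow> 0) at_top" by simp
    moreover have "\<forall>\<^sub>F x in at_top. complex_of_real (gm_eval G x / gm_eval M x) *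
        complex_of_real (gm_eval M x / gm_eval G x) = 1"
      using Gpos gm.pos[OF nfQ(2)] by eventually_elim simp
    ultimately have "((\<lambda>x::real. 1::complex) \<longlongrightarrow> 0) at_top"
      by (rule Lim_transform_eventually)
    then show ?thesis by (simp add: tendsto_const_iff)
  qed
  have "((\<lambda>x::real. 1::complex) \<longlongrightarrow> C) at_top"
    by (rule Lim_transform_eventually[OF lim])
      (use GM Gpos in eventually_elim, simp)
  then have C: "C = 1" by (simp add: tendsto_const_iff)
  have "\<forall>\<^sub>F x in at_top. lincomb gm_eval r x = 0"
    using ev GM by eventually_elim (simp add: Q C scaleR_conv_of_real)
  then have r: "r = []"
    by (intro gm.normal_form_frequently_0[OF nfQ(3)] eventually_frequently) auto
  \<comment> \<open>Equality of \<open>M\<close> and \<open>G\<close> on the real axis is not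
    enough, since the continuation depends on the expression. Rigidity also makes \<open>M\<close>
    of gamma type with the same \<theta> and \<kappa>, leaving only \<open>H\<close> undetermined as
    syntax.\<close>
  have "((\<lambda>x::real. gm_eval M x / gm_eval G x) \<longlongrightarrow> 1) at_top"
    by (rule Lim_transform_eventually[OF tendsto_const])
      (use GM Gpos in eventually_elim, simp)
  from growth_monomials_similar[OF nfQ(2) G_growth this]
  obtain H where H: "M = GammaType (ln a) H k"
    "\<forall>\<^sub>F x::real in at_top. lx_eval H x = lx_eval (LogExp [] []) x"
    by (cases M) (auto simp: G_def)
  show ?thesis
    by (rule that[of H]) (use H in \<open>simp_all add: P Q C r pow_log_def\<close>)
qed

section \<open>The selector integrals and their recurrence\<close>

definition W :: "nat \<Rightarrow> real" where
  "W N = (LINT u|lborel. \<phi> u * exp (N * u) / (1 + exp u))"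

lemma W_integrable: "integrable lborel (\<lambda>u. \<phi> u * exp (real N * u) / (1 + exp u))"
proof (rule Bochner_Integration.integrable_bound)
  show "integrable lborel (\<lambda>u. \<phi> u * exp (real N * u))"
    using laplace_real[of "real N"] by (simp add: has_bochner_integral_iff)
  show "AE u in lborel. norm (\<phi> u * exp (real N * u) / (1 + exp u)) \<le> norm (\<phi> u * exp (real N * u))"
  proof (intro AE_I2)
    fix u :: real
    have x: "\<phi> u * exp (real N * u) \<ge> 0" using \<phi>_pos[of u] by simp
    then have "\<phi> u * exp (real N * u) / (1 + exp u) \<le> \<phi> u * exp (real N * u) / 1"
      by (intro divide_left_mono) (auto simp: add_pos_pos)
    with x show "norm (\<phi> u * exp (real N * u) / (1 + exp u)) \<le> norm (\<phi> u * exp (real N * u))"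
      by (simp add: add_pos_pos)
  qed
qed measurable

lemma W_nonneg: "W N \<ge> 0"
  unfolding W_def using \<phi>_pos by (intro Bochner_Integration.integral_nonneg) (simp add: less_imp_le add_pos_pos)

text \<open>The numerators add up to \<open>exp (N * u) * (1 + exp u)\<close>, which cancels the
  denominator and leaves the Laplace integral of \<phi> at \<open>N\<close>.\<close>

lemma W_add: "W N + W (Suc N) = a ^ N * fact (k * N)"
proof -
  have "W N + W (Suc N) = (LINT u|lborel. \<phi> u * exp (real N * u) / (1 + exp u) +
      \<phi> u * exp (real (Suc N) * u) / (1 + exp u))"
    unfolding W_def by (intro Bochner_Integration.integral_add[symmetric] W_integrable)
  also have "\<dots> = (LINT u|lborel. \<phi> u * exp (real N * u))"
  proof (intro Bochner_Integration.integral_cong refl)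
    fix u :: real
    have "1 + exp u \<noteq> 0" using exp_gt_zero[of u] by linarith
    then show "\<phi> u * exp (real N * u) / (1 + exp u) + \<phi> u * exp (real (Suc N) * u) / (1 + exp u) =
        \<phi> u * exp (real N * u)"
      by (simp add: add_divide_distrib[symmetric] exp_add algebra_simps) (simp add: field_simps)
  qed
  also have "\<dots> = gm_eval G (real N)"
    using laplace_real[of "real N"] by (simp add: has_bochner_integral_iff gm_eval_G)
  finally show ?thesis unfolding gm_eval_G_nat .
qed

text \<open>The substitution is read backwards with \<open>exp u = a * t ^ k\<close>. It yields the
  open half-line, to which the endpoint 0 is added as a null set.\<close>

lemma W_0: "W 0 = (LINT x:{0..}|lborel. exp (- x) / (1 + a * x ^ k))"
proof -
  let ?h = "\<lambda>x. exp (- x) / (1 + a * x ^ k)"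
  have "(\<lambda>u. \<phi> u * exp (real 0 * u) / (1 + exp u)) = (\<lambda>u. (\<tau> u / k) *\<^sub>R ?h (\<tau> u))"
    by (simp add: \<phi>_def \<tau>_pow)
  then have b: "has_bochner_integral lborel (\<lambda>u. (\<tau> u / k) *\<^sub>R ?h (\<tau> u)) (W 0)"
    using W_integrable[of 0] by (simp add: W_def has_bochner_integral_iff)
  have h: "?h absolutely_integrable_on {0<..}" "integral {0<..} ?h = W 0"
  proof -
    have "(\<lambda>u. ?h (\<tau> u)) \<in> borel_measurable borel" unfolding \<tau>_def by measurable
    with b show "?h absolutely_integrable_on {0<..}" "integral {0<..} ?h = W 0"
      using substitution[of ?h "W 0"] by blast+
  qed
  have "set_integrable lborel {0<..} ?h"
    using h(1) unfolding set_integrable_def by (subst (asm) integrable_completion) auto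
  from set_borel_integral_eq_integral(2)[OF this] h(2)
  have "W 0 = (LINT x:{0<..}|lborel. ?h x)" by simp
  also have "\<dots> = (LINT x:{0..}|lborel. ?h x)"
    unfolding set_lebesgue_integral_def
  proof (rule integral_cong_AE)
    show "AE x in lborel. indicator {0<..} x *\<^sub>R ?h x = indicator {0..} x *\<^sub>R ?h x"
      using AE_lborel_singleton[of 0] by eventually_elim (auto simp: indicator_def)
  qed measurable
  finally show ?thesis .
qed

text \<open>Stated for any \<open>c\<close> with these phase data, because it serves the explicit
  candidate as well as every other germ list that the definite description has to consider.\<close>

lemma selector_eq:
  assumes "phase_plus c = []" "\<And>u. bromwich (phase_minus c) u = of_real (\<phi> u)"
  shows "selector c N = (-1) ^ N * of_real (W N)"
    and "sel_minus_exists (phase_minus c) N"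
proof -
  have I: "sel_minus_integrand (phase_minus c) N = (\<lambda>u. of_real (\<phi> u * exp (real N * u) / (1 + exp u)))"
    by (simp add: sel_minus_integrand_def fun_eq_iff assms)
  have "sel_minus (phase_minus c) N = of_real (W N)"
    unfolding sel_minus_def W_def I by (rule integral_complex_of_real)
  then show "selector c N = (-1) ^ N * of_real (W N)"
    by (simp add: selector_def assms(1) sel_plus_Nil)
  show "sel_minus_exists (phase_minus c) N"
    unfolding sel_minus_exists_def I using W_integrable by (intro integrable_of_real)
qed

definition c\<^sub>0 :: "((complex \<times> complex) \<times> gmon) list" where "c\<^sub>0 = [((0, 1), G)]"

lemma phases_c0: "phase_plus c\<^sub>0 = []" "phase_minus c\<^sub>0 = [(1, G)]"
  by (simp_all add: c\<^sub>0_def phase_plus_def phase_minus_def)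

lemma bromwich_G: "bromwich [(1, G)] u = of_real (\<phi> u)"
  by (rule bromwich_eqI[OF eventually_mono[OF eventually_gt_at_top[of 0]]]) (rule bromwich_line_G(2))

lemma bromwich_admissible_G: "bromwich_admissible [(1, G)]"
proof -
  have "integrable lborel (\<lambda>u. complex_of_real (\<phi> u) * of_real (exp (real N * u))) \<and>
      (LINT u|lborel. complex_of_real (\<phi> u) * of_real (exp (real N * u))) = MF_germ [(1, G)] (real N)" for N
    using laplace_real[of "real N"]
    by (simp add: has_bochner_integral_iff MF_germ_def gm_eval_G flip: of_real_mult)
  then show ?thesis
    unfolding bromwich_admissible_def using G_growth
    by (auto simp: MF_def bromwich_line_G intro!: exI[of _ 0])
qed

lemma selects_c0:
  assumes R: "\<And>N. R N - R (Suc N) = (-1) ^ N * fact (k * N) * of_real a ^ N"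
  shows "selects c\<^sub>0 R"
  unfolding selects_def
proof (intro conjI)
  show "c\<^sub>0 \<in> MM" using G_growth by (simp add: c\<^sub>0_def MM_def)
  have "MM_germ c\<^sub>0 (real N) = R N - R (Suc N)" for N
    using gm_eval_G_nat[of N] unfolding MM_germ_phase_split exp_pi_nat phases_c0 R
    by (simp add: MF_germ_def)
  then show "\<forall>\<^sub>F N in sequentially. MM_germ c\<^sub>0 (real N) = R N - R (Suc N)" by simp
  show "admits_selector c\<^sub>0"
    using selector_eq(2)[of c\<^sub>0] 
    by (simp add: admits_selector_def phases_c0 bromwich_G bromwich_admissible_Nil
        bromwich_admissible_G sel_plus_Nil)
  have sel: "selector c\<^sub>0 N = (-1) ^ N * of_real (W N)" for N
    by (rule selector_eq) (simp_all add: phases_c0 bromwich_G)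
  \<comment> \<open>Consecutive selector values have opposite signs and \<open>W\<close> is
    nonnegative, so the norms add up in the difference. Hence \<epsilon> = 1 works in the
    nonresonance condition.\<close>
  have "norm (selector c\<^sub>0 N - selector c\<^sub>0 (Suc N)) \<ge> 1 * norm (selector c\<^sub>0 N)" for N
  proof -
    have "selector c\<^sub>0 N - selector c\<^sub>0 (Suc N) = (-1) ^ N * of_real (W N + W (Suc N))"
      by (simp add: sel algebra_simps)
    then have "norm (selector c\<^sub>0 N - selector c\<^sub>0 (Suc N)) = W N + W (Suc N)"
      using W_nonneg[of N] W_nonneg[of "Suc N"] by (simp add: norm_mult norm_power del: of_real_add)
    moreover have "norm (selector c\<^sub>0 N) = W N"
      using W_nonneg[of N] by (simp add: sel norm_mult norm_power)
    ultimately show ?thesis using W_nonneg[of "Suc N"] by simp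
  qed
  then show "shift_nonresonant (selector c\<^sub>0)"
    unfolding shift_nonresonant_def by (intro disjI2 exI[of _ 1]) auto
qed

text \<open>The coefficient \<open>H\<close> is only known to be 1 on the real axis, but the Bromwich integral sees its
  continuation, so the identity theorem is needed.\<close>

lemma selector_unique:
  assumes R: "\<And>N. R N - R (Suc N) = (-1) ^ N * fact (k * N) * of_real a ^ N"
    and "selects c R"
  shows "selector c N = (-1) ^ N * of_real (W N)"
proof -
  have "\<forall>\<^sub>F N in sequentially. MM_germ c (real N) = R N - R (Suc N)" "c \<in> MM"
    using assms(2) by (auto simp: selects_def)
  then have "\<forall>\<^sub>F N in sequentially. MM_germ c (real N) = (-1) ^ N * of_real (gm_eval G (real N))"
    by (simp add: R gm_eval_G_nat mult_ac)
  from phases_of_selected[OF \<open>c \<in> MM\<close> this] obtain H where H: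
    "phase_plus c = []" "phase_minus c = [(1, GammaType (ln a) H k)]"
    "\<forall>\<^sub>F x::real in at_top. lx_eval H x = 1" .
  have "\<forall>\<^sub>F \<sigma> in at_top. \<forall>z::complex. Re z > \<sigma> \<longrightarrow> lx_eval H z = lx_eval (LogExp [] []) z"
    by (rule lx_eval_continuation_unique) (use H(3) in \<open>simp add: pow_log_def\<close>)
  then obtain \<sigma>1 where \<sigma>1: "\<And>z::complex. Re z > \<sigma>1 \<Longrightarrow> lx_eval H z = lx_eval (LogExp [] []) z"
    using eventually_happens'[OF trivial_limit_at_top_linorder] by blast
  \<comment> \<open>The line must lie to the right of 0 for the transform of \<open>G\<close>, and
    to the right of \<open>\<sigma>1\<close> for the continuation of \<open>H\<close> to equal 1 on
    it.\<close>
  have line: "\<forall>\<^sub>F \<sigma> in at_top. bromwich_line (phase_minus c) \<sigma> u = of_real (\<phi> u)" for u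
    using eventually_gt_at_top[of "max 0 \<sigma>1"]
  proof eventually_elim
    case (elim \<sigma>)
    then have "bromwich_integrand (phase_minus c) \<sigma> u = bromwich_integrand [(1, G)] \<sigma> u"
      using \<sigma>1 by (simp add: bromwich_integrand_def fun_eq_iff MF_cont_def H(2) G_def gamma_germ_def)
    then have "bromwich_line (phase_minus c) \<sigma> u = bromwich_line [(1, G)] \<sigma> u"
      by (simp add: bromwich_line_def)
    with elim show ?case by (simp add: bromwich_line_G)
  qed
  show ?thesis by (rule selector_eq[OF H(1) bromwich_eqI[OF line]])
qed

section \<open>The finite part and the value of the sum\<close>

lemma FP_inf_eq:
  assumes R: "\<And>N. R N - R (Suc N) = (-1) ^ N * fact (k * N) * of_real a ^ N"
  shows "MM_admissible R" "FP_inf R = R 0 - of_real (W 0)"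
proof -
  show "MM_admissible R" using selects_c0[OF R] by (auto simp: MM_admissible_def)
  \<comment> \<open>\<open>R\<close> and the selector have the same differences at every
    \<open>N\<close>, not only at large \<open>N\<close>. The eventual constant is therefore already
    attained at 0.\<close>
  have const: "R N - (-1) ^ N * of_real (W N) = R 0 - of_real (W 0)" for N
  proof (induction N)
    case (Suc N)
    have "R N - R (Suc N) = (-1) ^ N * of_real (W N + W (Suc N))"
      using R[of N] unfolding W_add by simp
    then have "R (Suc N) - (-1) ^ Suc N * of_real (W (Suc N)) = R N - (-1) ^ N * of_real (W N)"
      by (simp add: algebra_simps)
    then show ?case using Suc by simp
  qed simp
  have "\<not> (\<forall>\<^sub>F N in sequentially. R N - R (Suc N) = 0)"
    using a by (simp add: R)
  then have "FP_inf R = (THE v. \<exists>c. selects c R \<and> (\<forall>\<^sub>F N in sequentially. R N - selector c N = v))"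
    by (simp add: FP_inf_def)
  also have "\<dots> = R 0 - of_real (W 0)"
  proof (rule the_equality)
    show "\<exists>c. selects c R \<and> (\<forall>\<^sub>F N in sequentially. R N - selector c N = R 0 - of_real (W 0))"
      using selects_c0[OF R] selector_unique[OF R selects_c0[OF R]] const by auto
    fix v assume "\<exists>c. selects c R \<and> (\<forall>\<^sub>F N in sequentially. R N - selector c N = v)"
    then obtain c where "selects c R" "\<forall>\<^sub>F N in sequentially. R N - selector c N = v" by blast
    then show "v = R 0 - of_real (W 0)"
      using selector_unique[OF R] const by simp
  qed
  finally show "FP_inf R = R 0 - of_real (W 0)" .
qed

text \<open>The equivalence gives existence and, for the definite description, uniqueness. For any
  presentation and solution the tail at 0 is \<open>A n0 * I n0\<close>, so this term cancels
  against the finite part and only \<open>W 0\<close> remains.\<close>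

lemma has_C_sum_iff:
  "has_C_sum (\<lambda>n. (-1) ^ n * fact (k * n) * of_real a ^ n) v \<longleftrightarrow> v = of_real (W 0)" (is "has_C_sum ?s v \<longleftrightarrow> _")
proof
  assume "has_C_sum ?s v"
  then obtain n0 A B \<mu> I where p: "recurrence_presentation ?s n0 A B \<mu>" "recurrence_solution n0 A B \<mu> I"
    and v: "v = A n0 * I n0 - FP_inf (normalized_tail n0 A B I)"
    unfolding has_C_sum_def by blast
  have "normalized_tail n0 A B I 0 = A n0 * I n0" by (simp add: normalized_tail_def)
  with FP_inf_eq(2)[OF normalized_tail_diff[OF p]] v show "v = of_real (W 0)" by simp
next
  assume v: "v = of_real (W 0)"
  \<comment> \<open>With all coefficients equal to 1 the recurrence reads
    \<open>I n + I (n + 1) = fact (k * n) * a ^ n\<close>, and the selector integrals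
    \<open>W\<close> solve it.\<close>
  let ?\<mu> = "\<lambda>n. fact (k * n) * of_real a ^ n :: complex" and ?I = "\<lambda>n. complex_of_real (W n)"
  have p: "recurrence_presentation ?s 0 (\<lambda>_. 1) (\<lambda>_. 1) ?\<mu>"
    by (simp add: recurrence_presentation_def)
  have "W n + W (Suc n) = fact (k * n) * a ^ n" for n using W_add[of n] by simp
  then have "?I n + ?I (Suc n) = ?\<mu> n" for n
    by (metis of_real_add of_real_mult of_real_fact of_real_power)
  then have q: "recurrence_solution 0 (\<lambda>_. 1) (\<lambda>_. 1) ?\<mu> ?I"
    by (simp add: recurrence_solution_def)
  note FP = FP_inf_eq[OF normalized_tail_diff[OF p q]]
  have "v = 1 * ?I 0 - FP_inf (normalized_tail 0 (\<lambda>_. 1) (\<lambda>_. 1) ?I)"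
    unfolding FP(2) by (simp add: v normalized_tail_def)
  with p q FP(1) show "has_C_sum ?s v" unfolding has_C_sum_def by blast
qed

end

theorem theorem9p1:
  fixes k :: nat and a :: real
  assumes "k \<ge> 1" and "a > 0"
  shows "C_summable (\<lambda>n. (-1) ^ n * fact (k * n) * of_real a ^ n) \<and>
         C_sum (\<lambda>n. (-1) ^ n * fact (k * n) * of_real a ^ n) =
           of_real (LINT x:{0..}|lborel. exp (- x) / (1 + a * x ^ k))"
proof -
  interpret factorial_series k a using assms by unfold_locales
  show ?thesis
    unfolding C_summable_def C_sum_def has_C_sum_iff W_0[symmetric] by simp
qed

end
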